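(* The two recurrences $$a_{n+1,k}+n^2a_{n-1,k}=a_{n,k+1}+(2n-1)a_{n,k}+a_{n,k-1}\qquad(1)$$ and $$(n+1)^2\,(a_{n,k}+a_{n,k+1})=(n-k+1)\,a_{n+1,k}+(n+k+1)\,a_{n+1,k+1}\qquad(2)$$ are both valid in the region $n/2\le k$ (for integers $n\ge 1$ and $k$).
   Context: $S_n$ is the symmetric group on $\{1,\dots,n\}$. For $\sigma\in S_n$, $\mathrm{LIS}(\sigma)$ denotes the length of the longest increasing subsequence of $\sigma$, and $a_{n,k}:=\#\{\sigma\in S_n\mid \mathrm{LIS}(\sigma)=k\}$ is the number of permutations of length $n$ whose longest increasing subsequence has length exactly $k$. Convention: $a_{n,k}=0$ when $k<1$ or $k>n$.
   Formalization: Recurrence (1) is proved only for k > n/2: on the boundary n = 2k it is false (n = 2, k = 1 gives 5 on the left and 4 on the right; in general the sides differ by the square of the k-th Catalan number). Recurrence (2) is proved for all k ≥ n/2. *)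

theory Defs
  imports Complex_Main "HOL-Combinatorics.Permutations"
begin

(* An increasing subsequence of the word \<sigma>(1), ..., \<sigma>(n) is identified with the set S of
   positions that it occupies. *)
definition LIS :: "nat \<Rightarrow> (nat \<Rightarrow> nat) \<Rightarrow> nat" where
  "LIS n \<sigma> = Max {card S | S. S \<subseteq> {1..n} \<and> strict_mono_on S \<sigma>}"

(* The guard only matters at n = k = 0, where the empty permutation would otherwise be counted. *)
definition num_LIS :: "nat \<Rightarrow> int \<Rightarrow> nat" where
  "num_LIS n k = (if 1 \<le> k \<and> k \<le> int n
            then card {\<sigma>. \<sigma> permutes {1..n} \<and> int (LIS n \<sigma>) = k} else 0)"

end

theory Submission
  imports Defs "HOL-Combinatorics.Multiset_Permutations"
begin

text \<open>
By the Robinson--Schensted correspondence, the permutations of \<open>n\<close> elements with longest increasing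
subsequence of length \<open>k\<close> are counted by \<open>\<Sum> f(\<lambda>)\<^sup>2\<close>, where \<open>\<lambda>\<close> runs through the partitions of \<open>n\<close>
with first row \<open>k\<close> and \<open>f(\<lambda>)\<close> is the number of standard Young tableaux of shape \<open>\<lambda>\<close>. Write
\<open>\<lambda> = (k, \<mu>)\<close>. As soon as \<open>n \<le> 2 k + 1\<close>, almost every partition \<open>\<mu>\<close> of \<open>n - k\<close> fits below a first row
of length \<open>k\<close>, so the two parts of \<open>\<lambda>\<close> hardly see each other, and this is where the recurrences come
from.

\<^bold>\<open>Counting by tableaux.\<close> Only the first row of the insertion tableau matters for the longest
increasing subsequence (\<open>LIS_eq_card_row\<close>), and it evolves on its own under insertion. Undoing the last
insertion gives a recursion for the number of words with a given first row (\<open>card_row_lists_rec\<close>). The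
same recursion is produced by removing a box from a generating vector of tableaux with a given first
row; this follows from the commutation relations between adding and removing boxes
(\<open>down_below_tableaux\<close>). Hence no full insertion algorithm is needed to reach \<open>\<Sum> f(\<lambda>)\<^sup>2\<close>
(\<open>card_LIS_eq_sum_walks\<close>).

\<^bold>\<open>Freeing the first row.\<close> By the reflection principle, \<open>f\<close> extends to an alternating function on
all integer points, a signed count of lattice walks, which vanishes when two coordinates agree. For
\<open>n \<le> 2 k + 1\<close> the pairs \<open>(k, \<mu>)\<close> that are not partitions lie on such a wall, so the sum of squares
may be extended over all partitions \<open>\<mu>\<close> of \<open>n - k\<close> (\<open>norm_walks_eq_chamber_0\<close>). Call the extended sum
\<open>A(n, k)\<close>. Now adding a box to the first row is an invertible shift, and adding and removing boxes
of \<open>\<mu>\<close> are adjoint operators \<open>U\<close>, \<open>D\<close> with \<open>D U - U D = 1\<close>. Expanding the norm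
\<open>A(n + 1, k)\<close> with these rules gives the first recurrence for \<open>A\<close>, for all \<open>k\<close>, given enough rows (\<open>norm_walks_rec\<close>). For
\<open>k = n / 2\<close> the term with \<open>k - 1\<close> leaves the range in which \<open>A\<close> counts permutations, which is why
the first recurrence is claimed only above that line.

\<^bold>\<open>Solving the recurrence.\<close> The first recurrence, together with \<open>A(0, k) = 1\<close> for \<open>k \<le> 0\<close> and
\<open>A(0, k) = 0\<close> for \<open>k > 0\<close>, determines \<open>A\<close>. The solution is a single sum
\<open>\<Sum>\<^sub>t w(t, k) (n choose t)\<^sup>2 (n - t)!\<close> (\<open>norm_walks_eq_closed_form\<close>), and for this sum the second
recurrence holds term by term (\<open>closed_form_adjacent\<close>).
\<close>

section \<open>The first row of Schensted insertion\<close>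

definition bump :: "nat \<Rightarrow> nat set \<Rightarrow> nat set" where
  "bump v R = insert v (R - {u \<in> R. v < u \<and> (\<forall>w\<in>R. v < w \<longrightarrow> u \<le> w)})"

text \<open>
The word is read from the right: \<open>row (v # xs)\<close> inserts \<open>v\<close> last, so that removing the most recent
letter is list recursion.
\<close>

fun row :: "nat list \<Rightarrow> nat set" where
  "row [] = {}"
| "row (v # xs) = bump v (row xs)"

lemma row_subset: "row xs \<subseteq> set xs"
  by (induction xs) (auto simp: bump_def)

lemma finite_row: "finite (row xs)"
  using row_subset finite_subset by blast

lemma bump_cases:
  assumes "finite R" "v \<notin> R"
  obtains (append) "\<forall>w\<in>R. w < v" "bump v R = insert v R"
  | (replace) u where "u \<in> R" "v < u" "\<forall>w\<in>R. \<not> (v < w \<and> w < u)" "bump v R = insert v (R - {u})"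
proof (cases "\<forall>w\<in>R. w < v")
  case True
  then have "bump v R = insert v R" by (auto simp: bump_def)
  with True show thesis by (rule append)
next
  case False
  define u where "u = Min {w \<in> R. v < w}"
  have ne: "{w \<in> R. v < w} \<noteq> {}"
    using False assms(2) by (metis (mono_tags, lifting) empty_Collect_eq linorder_neqE_nat)
  have "u \<in> {w \<in> R. v < w}" unfolding u_def using assms(1) ne by (intro Min_in) auto
  moreover have "\<forall>w\<in>R. v < w \<longrightarrow> u \<le> w" unfolding u_def using assms(1) by auto
  ultimately have u: "u \<in> R" "v < u" "\<forall>w\<in>R. v < w \<longrightarrow> u \<le> w" by auto
  have "{u' \<in> R. v < u' \<and> (\<forall>w\<in>R. v < w \<longrightarrow> u' \<le> w)} = {u}"
    using u by (auto intro: antisym)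
  then have "bump v R = insert v (R - {u})" by (simp add: bump_def)
  with u show thesis by (intro replace[of u]) (auto simp: not_less)
qed

lemma card_bump_atMost:
  assumes "finite R" "v \<notin> R"
  shows "card {w \<in> bump v R. w \<le> t} =
    (if t < v then card {w \<in> R. w \<le> t}
     else max (card {w \<in> R. w \<le> t}) (card {w \<in> R. w \<le> v} + 1))"
  using assms
proof (cases rule: bump_cases)
  case append
  show ?thesis
  proof (cases "t < v")
    case True
    then have "{w \<in> bump v R. w \<le> t} = {w \<in> R. w \<le> t}" using append by auto
    then show ?thesis using True by simp
  next
    case False
    have "{w \<in> bump v R. w \<le> t} = insert v R" "{w \<in> R. w \<le> t} = R" "{w \<in> R. w \<le> v} = R"
      using append False by force+
    then show ?thesis using False assms by simp
  qed
next
  case (replace u)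
  show ?thesis
  proof (cases "t < v")
    case True
    then have "{w \<in> bump v R. w \<le> t} = {w \<in> R. w \<le> t}" using replace by auto
    then show ?thesis using True by simp
  next
    case tv: False
    show ?thesis
    proof (cases "t < u")
      case True
      have "{w \<in> R. w \<le> t} = {w \<in> R. w \<le> v}" using replace True tv
        by (auto simp: not_less)
      moreover have "{w \<in> bump v R. w \<le> t} = insert v {w \<in> R. w \<le> t}"
        using replace True tv by auto
      ultimately show ?thesis using tv assms by simp
    next
      case False
      have "{w \<in> bump v R. w \<le> t} = insert v ({w \<in> R. w \<le> t} - {u})"
        using replace False tv by auto
      moreover have "u \<in> {w \<in> R. w \<le> t}" using replace False by auto
      ultimately have eq: "card {w \<in> bump v R. w \<le> t} = card {w \<in> R. w \<le> t}"
        using assms card_gt_0_iff[of "{w \<in> R. w \<le> t}"] by (auto simp: card_Diff_singleton)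
      have "{w \<in> R. w \<le> v} \<subset> {w \<in> R. w \<le> t}"
        using replace(1,2) False by (intro psubsetI subsetI notI) (auto simp: set_eq_iff not_less dest: spec[of _ u])
      then have "card {w \<in> R. w \<le> v} < card {w \<in> R. w \<le> t}"
        using assms(1) by (intro psubset_card_mono) auto
      then show ?thesis using eq tv by simp
    qed
  qed
qed

text \<open>
Schensted's theorem in a form that carries an induction: for every bound \<open>t\<close>, the entries of the row up
to \<open>t\<close> count the longest increasing subsequence with values at most \<open>t\<close>. An increasing subsequence that
uses the newest letter \<open>v\<close> is one with values below \<open>v\<close> prolonged by \<open>v\<close>, and \<open>card_bump_atMost\<close> says
that the row records exactly this maximum.
\<close>

lemma card_row_atMost:
  assumes "inj_on \<sigma> {1..n}"
  defines "R \<equiv> row (rev (map \<sigma> [1..<n + 1]))"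
  defines "I \<equiv> (\<lambda>t S. S \<subseteq> {1..n} \<and> strict_mono_on S \<sigma> \<and> (\<forall>i\<in>S. \<sigma> i \<le> t))"
  shows "(\<exists>S. I t S \<and> card S = card {w \<in> R. w \<le> t}) \<and> (\<forall>S. I t S \<longrightarrow> card S \<le> card {w \<in> R. w \<le> t})"
  using assms(1) unfolding R_def I_def
proof (induction n arbitrary: t)
  case 0
  then show ?case by auto
next
  case (Suc n)
  define R where "R = row (rev (map \<sigma> [1..<n + 1]))"
  define v where "v = \<sigma> (Suc n)"
  define M where "M = (\<lambda>t. card {w \<in> R. w \<le> t})"
  have inj: "inj_on \<sigma> {1..n}" by (rule inj_on_subset[OF Suc.prems]) auto
  have IHe: "\<exists>S. S \<subseteq> {1..n} \<and> strict_mono_on S \<sigma> \<and> (\<forall>i\<in>S. \<sigma> i \<le> t) \<and> card S = M t" for t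
    using Suc.IH[OF inj, of t] by (auto simp: M_def R_def)
  have IHb: "card S \<le> M t" if "S \<subseteq> {1..n}" "strict_mono_on S \<sigma>" "\<forall>i\<in>S. \<sigma> i \<le> t" for S t
    using Suc.IH[OF inj, of t] that by (auto simp: M_def R_def)
  have "R \<subseteq> \<sigma> ` {1..n}" unfolding R_def using row_subset[of "rev (map \<sigma> [1..<n + 1])"]
    by (force simp: atLeastLessThanSuc_atLeastAtMost)
  moreover have ne: "\<sigma> i \<noteq> v" if "i \<in> {1..n}" for i
    using Suc.prems that unfolding v_def inj_on_def by force
  ultimately have vR: "v \<notin> R" by blast
  have fR: "finite R" unfolding R_def by (rule finite_row)
  have R': "row (rev (map \<sigma> [1..<Suc n + 1])) = bump v R"
    by (simp add: R_def v_def)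
  have M': "card {w \<in> bump v R. w \<le> t} = (if t < v then M t else max (M t) (M v + 1))"
    unfolding M_def by (rule card_bump_atMost[OF fR vR])
  have ex: "\<exists>S. S \<subseteq> {1..Suc n} \<and> strict_mono_on S \<sigma> \<and> (\<forall>i\<in>S. \<sigma> i \<le> t) \<and> card S = card {w \<in> bump v R. w \<le> t}"
  proof (cases "t < v \<or> M v + 1 \<le> M t")
    case True
    then have "card {w \<in> bump v R. w \<le> t} = M t" unfolding M' by auto
    moreover obtain S where S: "S \<subseteq> {1..n}" "strict_mono_on S \<sigma>" "\<forall>i\<in>S. \<sigma> i \<le> t" "card S = M t"
      using IHe by blast
    moreover have "S \<subseteq> {1..Suc n}" using S(1) by auto
    ultimately show ?thesis by metis
  next
    case False
    then have c: "card {w \<in> bump v R. w \<le> t} = M v + 1" and vt: "v \<le> t" unfolding M' by auto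
    obtain S where S: "S \<subseteq> {1..n}" "strict_mono_on S \<sigma>" "\<forall>i\<in>S. \<sigma> i \<le> v" "card S = M v"
      using IHe by blast
    have lt: "\<sigma> i < v" "i < Suc n" if "i \<in> S" for i
      using S that ne[of i] by (force simp: less_le)+
    have "strict_mono_on (insert (Suc n) S) \<sigma>"
      using S(2) lt unfolding strict_mono_on_def v_def by force
    moreover have "card (insert (Suc n) S) = M v + 1"
      using S lt finite_subset[OF S(1)] by (subst card_insert_disjoint) auto
    moreover have "insert (Suc n) S \<subseteq> {1..Suc n}" using S by auto
    moreover have "\<forall>i\<in>insert (Suc n) S. \<sigma> i \<le> t" using S vt v_def by auto
    ultimately show ?thesis unfolding c by blast
  qed
  have bd: "card S \<le> card {w \<in> bump v R. w \<le> t}"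
    if S: "S \<subseteq> {1..Suc n}" "strict_mono_on S \<sigma>" "\<forall>i\<in>S. \<sigma> i \<le> t" for S
  proof (cases "Suc n \<in> S")
    case False
    then have "S \<subseteq> {1..n}" using S(1) by (auto simp: le_Suc_eq)
    then have "card S \<le> M t" using S IHb by blast
    then show ?thesis unfolding M' by auto
  next
    case True
    have "S - {Suc n} \<subseteq> {1..n}" using S(1) by (auto simp: le_Suc_eq)
    moreover have "strict_mono_on (S - {Suc n}) \<sigma>"
      using S(2) unfolding strict_mono_on_def by auto
    moreover have "\<forall>i\<in>S - {Suc n}. \<sigma> i \<le> v"
    proof
      fix i assume i: "i \<in> S - {Suc n}"
      then have "i < Suc n" using S(1) by force
      then have "\<sigma> i < v" unfolding v_def using S(2) i True by (auto simp: strict_mono_on_def)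
      then show "\<sigma> i \<le> v" by simp
    qed
    ultimately have "card (S - {Suc n}) \<le> M v" by (rule IHb)
    then have "card S \<le> M v + 1" using True finite_subset[OF S(1)] by (simp add: card_Diff_singleton)
    moreover have "v \<le> t" using S(3) True v_def by auto
    ultimately show ?thesis unfolding M' by auto
  qed
  show ?case unfolding R' using ex bd by blast
qed

lemma LIS_eq_card_row:
  assumes "inj_on \<sigma> {1..n}"
  shows "LIS n \<sigma> = card (row (rev (map \<sigma> [1..<n + 1])))"
proof -
  define R where "R = row (rev (map \<sigma> [1..<n + 1]))"
  define t where "t = Max (insert 0 (\<sigma> ` {1..n}))"
  have le: "\<sigma> i \<le> t" if "i \<in> {1..n}" for i
    using that unfolding t_def by (intro Max_ge) auto
  have "R \<subseteq> \<sigma> ` {1..n}" unfolding R_def using row_subset[of "rev (map \<sigma> [1..<n + 1])"]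
    by (force simp: atLeastLessThanSuc_atLeastAtMost)
  then have R: "{w \<in> R. w \<le> t} = R" using le by blast
  note * = card_row_atMost[OF assms, of t, folded R_def, unfolded R]
  show ?thesis unfolding LIS_def R_def[symmetric]
  proof (rule Max_eqI)
    show "finite {card S |S. S \<subseteq> {1..n} \<and> strict_mono_on S \<sigma>}"
      by (rule finite_surj[of "Pow {1..n}" _ card]) auto
  next
    fix y assume "y \<in> {card S |S. S \<subseteq> {1..n} \<and> strict_mono_on S \<sigma>}"
    then show "y \<le> card R" using * le by blast
  next
    obtain S where "S \<subseteq> {1..n}" "strict_mono_on S \<sigma>" "card S = card R" using * by blast
    then show "card R \<in> {card S |S. S \<subseteq> {1..n} \<and> strict_mono_on S \<sigma>}"
      by (intro CollectI exI[of _ S]) auto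
  qed
qed

section \<open>Counting words by their first row\<close>

definition row_lists :: "nat set \<Rightarrow> nat set \<Rightarrow> nat list set" where
  "row_lists V R = {xs \<in> permutations_of_set V. row xs = R}"

text \<open>
The ways in which the row \<open>R\<close> of a word with letters \<open>V\<close> can result from a bump: the last letter \<open>v\<close>
took the place of \<open>u\<close>.
\<close>

definition reverse_bumps :: "nat set \<Rightarrow> nat set \<Rightarrow> (nat \<times> nat) set" where
  "reverse_bumps V R = {(v, u). v \<in> R \<and> u \<in> V - R \<and> v < u \<and> (\<forall>w\<in>R. \<not> (v < w \<and> w < u))}"

lemma finite_reverse_bumps: "finite V \<Longrightarrow> R \<subseteq> V \<Longrightarrow> finite (reverse_bumps V R)"
  by (rule finite_subset[of _ "V \<times> V"]) (auto simp: reverse_bumps_def)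

lemma finite_row_lists: "finite (row_lists V R)"
  by (simp add: row_lists_def)

lemma bump_preimages:
  assumes "finite R"
  shows "(finite R' \<and> v \<notin> R' \<and> R' \<subseteq> V \<and> v \<in> V \<and> bump v R' = R) \<longleftrightarrow>
    (R \<subseteq> V \<and> ((R \<noteq> {} \<and> v = Max R \<and> R' = R - {Max R}) \<or>
    (\<exists>u. (v, u) \<in> reverse_bumps V R \<and> R' = insert u (R - {v}))))"
    (is "?L \<longleftrightarrow> ?R")
proof
  assume L: ?L
  then have "finite R'" "v \<notin> R'" by auto
  then show ?R
  proof (cases rule: bump_cases)
    case append
    then have R: "R = insert v R'" using L by auto
    then have "v = Max R" using append L by (intro Max_eqI[symmetric]) auto
    then show ?thesis using R L by auto
  next
    case (replace u)
    then have R: "R = insert v (R' - {u})" using L by auto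
    then have "(v, u) \<in> reverse_bumps V R" "R' = insert u (R - {v})"
      using replace L by (auto simp: reverse_bumps_def)
    moreover have "R \<subseteq> V" using R L by auto
    ultimately show ?thesis by blast
  qed
next
  assume R: ?R
  show ?L
  proof (cases "R \<noteq> {} \<and> v = Max R \<and> R' = R - {Max R}")
    case True
    then have "v \<in> R" "\<forall>w\<in>R'. w < v"
      using assms Max_in[of R] Max_ge[of R] by (auto simp: less_le)
    then have "bump v R' = insert v R'" by (force simp: bump_def)
    moreover have "insert v R' = R" "v \<in> V" using True R \<open>v \<in> R\<close> by auto
    ultimately show ?thesis using True R assms by auto
  next
    case False
    then obtain u where u: "(v, u) \<in> reverse_bumps V R" "R' = insert u (R - {v})" using R by blast
    have "u \<in> R'" "v < u" "\<forall>w\<in>R'. v < w \<longrightarrow> u \<le> w"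
      using u by (auto simp: reverse_bumps_def not_less)
    then have "{u' \<in> R'. v < u' \<and> (\<forall>w\<in>R'. v < w \<longrightarrow> u' \<le> w)} = {u}"
      by (auto intro: antisym)
    then have "bump v R' = R" using u by (auto simp: bump_def reverse_bumps_def)
    then show ?thesis using u assms R by (auto simp: reverse_bumps_def)
  qed
qed

text \<open>
The last letter was either appended, and then is the maximum of the row, or it bumped some \<open>u\<close>.
\<close>

lemma card_row_lists_rec:
  assumes V: "finite V" "V \<noteq> {}" and R: "R \<subseteq> V"
  shows "card (row_lists V R) =
    (if R = {} then 0 else card (row_lists (V - {Max R}) (R - {Max R}))) +
    (\<Sum>(v, u)\<in>reverse_bumps V R. card (row_lists (V - {v}) (insert u (R - {v}))))"
proof -
  define P where "P = {(v, R'). finite R' \<and> v \<notin> R' \<and> R' \<subseteq> V \<and> v \<in> V \<and> bump v R' = R}"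
  define Q1 where "Q1 = (if R = {} then {} else {(Max R, R - {Max R})})"
  define Q2 where "Q2 = (\<lambda>(v, u). (v, insert u (R - {v}))) ` reverse_bumps V R"
  have fR: "finite R" using V R finite_subset by blast
  have P: "P = Q1 \<union> Q2"
    unfolding P_def Q1_def Q2_def bump_preimages[OF fR] using R
    by (auto simp: image_iff split: if_splits)
  have fin: "finite Q1" "finite Q2" "finite P"
    unfolding P Q1_def Q2_def using finite_reverse_bumps[OF V(1) R] by auto
  have disj: "Q1 \<inter> Q2 = {}"
    unfolding Q1_def Q2_def using R by (auto simp: reverse_bumps_def)
  have inj: "inj_on (\<lambda>(v, u). (v, insert u (R - {v}))) (reverse_bumps V R)"
    by (auto simp: inj_on_def reverse_bumps_def)
  have "row_lists V R = (\<Union>(v, R')\<in>P. (#) v ` row_lists (V - {v}) R')"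
  proof (intro equalityI subsetI)
    fix xs assume xs: "xs \<in> row_lists V R"
    then obtain v ys where vys: "xs = v # ys" using V by (cases xs) (auto simp: row_lists_def permutations_of_set_def)
    have "(v, row ys) \<in> P" "ys \<in> row_lists (V - {v}) (row ys)"
      using xs row_subset[of ys] finite_row[of ys] unfolding P_def vys by (auto simp: row_lists_def permutations_of_set_def)
    then show "xs \<in> (\<Union>(v, R')\<in>P. (#) v ` row_lists (V - {v}) R')" unfolding vys by blast
  next
    fix xs assume "xs \<in> (\<Union>(v, R')\<in>P. (#) v ` row_lists (V - {v}) R')"
    then show "xs \<in> row_lists V R" by (auto simp: P_def row_lists_def permutations_of_set_def)
  qed
  also have "card \<dots> = (\<Sum>p\<in>P. card ((\<lambda>(v, R'). (#) v ` row_lists (V - {v}) R') p))"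
    using fin V by (intro card_UN_disjoint) (auto intro!: finite_imageI finite_row_lists simp: row_lists_def)
  also have "\<dots> = (\<Sum>(v, R')\<in>P. card (row_lists (V - {v}) R'))"
    by (intro sum.cong) (auto simp: card_image)
  also have "\<dots> = (\<Sum>(v, R')\<in>Q1. card (row_lists (V - {v}) R')) + (\<Sum>(v, R')\<in>Q2. card (row_lists (V - {v}) R'))"
    unfolding P by (rule sum.union_disjoint[OF fin(1,2) disj])
  also have "(\<Sum>(v, R')\<in>Q2. card (row_lists (V - {v}) R')) =
      (\<Sum>(v, u)\<in>reverse_bumps V R. card (row_lists (V - {v}) (insert u (R - {v}))))"
    unfolding Q2_def by (subst sum.reindex[OF inj]) (simp add: case_prod_unfold comp_def)
  finally show ?thesis by (simp add: Q1_def)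
qed

lemma card_LIS_eq_sum_row_lists:
  "card {\<sigma>. \<sigma> permutes {1..n} \<and> LIS n \<sigma> = k} = (\<Sum>R\<in>{R. R \<subseteq> {1..n} \<and> card R = k}. card (row_lists {1..n} R))"
proof -
  define f where "f = (\<lambda>\<sigma>::nat \<Rightarrow> nat. rev (map \<sigma> [1..<n + 1]))"
  have set_upt: "set [1..<n + 1] = {1..n}" by auto
  have "bij_betw f {\<sigma>. \<sigma> permutes {1..n}} (permutations_of_set {1..n})"
  proof (rule bij_betw_imageI)
    show inj: "inj_on f {\<sigma>. \<sigma> permutes {1..n}}"
    proof (rule inj_onI)
      fix \<sigma> \<tau> assume a: "\<sigma> \<in> {\<sigma>. \<sigma> permutes {1..n}}" "\<tau> \<in> {\<sigma>. \<sigma> permutes {1..n}}" "f \<sigma> = f \<tau>"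
      then have "\<forall>i\<in>{1..n}. \<sigma> i = \<tau> i" unfolding f_def set_upt[symmetric] by simp
      moreover have "\<sigma> i = \<tau> i" if "i \<notin> {1..n}" for i
        using a that by (auto simp: permutes_not_in)
      ultimately show "\<sigma> = \<tau>" by blast
    qed
    have sub: "f ` {\<sigma>. \<sigma> permutes {1..n}} \<subseteq> (permutations_of_set {1..n})"
    proof (rule image_subsetI)
      fix \<sigma> assume "\<sigma> \<in> {\<sigma>. \<sigma> permutes {1..n}}"
      then have "inj_on \<sigma> {1..n}" "\<sigma> ` {1..n} = {1..n}"
        by (simp_all add: permutes_inj_on permutes_image)
      then show "f \<sigma> \<in> permutations_of_set {1..n}"
        unfolding f_def permutations_of_set_def using set_upt by (simp add: distinct_map del: upt_Suc)
    qed
    show "f ` {\<sigma>. \<sigma> permutes {1..n}} = (permutations_of_set {1..n})"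
      using sub card_image[OF inj] card_permutations[of "{1..n}" n]
      by (intro card_subset_eq) auto
  qed
  then have "bij_betw f {\<sigma>\<in>{\<sigma>. \<sigma> permutes {1..n}}. LIS n \<sigma> = k}
      {xs\<in>(permutations_of_set {1..n}). card (row xs) = k}"
    by (rule bij_betw_Collect) (auto simp: f_def LIS_eq_card_row permutes_inj_on)
  then have "card {\<sigma>. \<sigma> permutes {1..n} \<and> LIS n \<sigma> = k} = card {xs \<in> permutations_of_set {1..n}. card (row xs) = k}"
    by (auto dest!: bij_betw_same_card)
  also have "{xs \<in> permutations_of_set {1..n}. card (row xs) = k} =
      (\<Union>R\<in>{R. R \<subseteq> {1..n} \<and> card R = k}. row_lists {1..n} R)"
    using row_subset by (auto simp: row_lists_def permutations_of_set_def)
  also have "card \<dots> = (\<Sum>R\<in>{R. R \<subseteq> {1..n} \<and> card R = k}. card (row_lists {1..n} R))"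
    by (intro card_UN_disjoint ballI finite_row_lists) (auto simp: row_lists_def permutations_of_set_def)
  finally show ?thesis .
qed

section \<open>Adding and removing boxes\<close>

text \<open>
A partition with rows \<open>\<lambda> 0, \<dots>, \<lambda> r\<close> is stored as the strictly decreasing sequence
\<open>x i = \<lambda> i + r - i\<close>. In these coordinates rows of a partition that are too long become
inversions, and the forbidden configurations next to the chamber of partitions are the points with two
equal coordinates.
\<close>

abbreviation inc :: "nat \<Rightarrow> (nat \<Rightarrow> int) \<Rightarrow> nat \<Rightarrow> int" where
  "inc j x \<equiv> x(j := x j + 1)"

abbreviation dec :: "nat \<Rightarrow> (nat \<Rightarrow> int) \<Rightarrow> nat \<Rightarrow> int" where
  "dec j x \<equiv> x(j := x j - 1)"

lemma sum_fun_upd: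
  fixes x :: "nat \<Rightarrow> int"
  assumes "j \<le> r"
  shows "(\<Sum>i\<le>r. (x(j := a)) i) = (\<Sum>i\<le>r. x i) - x j + a"
proof -
  have "(\<Sum>i\<le>r. (x(j := a)) i) = a + (\<Sum>i\<in>{..r} - {j}. x i)"
    using assms by (subst sum.remove[of _ j]) auto
  moreover have "(\<Sum>i\<le>r. x i) = x j + (\<Sum>i\<in>{..r} - {j}. x i)"
    using assms by (subst sum.remove[of _ j]) auto
  ultimately show ?thesis by simp
qed

context
  fixes r :: nat
begin

text \<open>
Only the rows from \<open>s\<close> on are ordered: \<open>chamber 0\<close> consists of the partitions, and \<open>chamber 1\<close> of the
pairs of an arbitrary integer, the first row, and a partition below it.
\<close>

definition chamber :: "nat \<Rightarrow> (nat \<Rightarrow> int) set" where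
  "chamber s = {x. (\<forall>i. s \<le> i \<and> i < r \<longrightarrow> x (Suc i) < x i) \<and> 0 \<le> x r \<and> (\<forall>i>r. x i = 0)}"

definition up :: "nat \<Rightarrow> nat \<Rightarrow> ((nat \<Rightarrow> int) \<Rightarrow> int) \<Rightarrow> (nat \<Rightarrow> int) \<Rightarrow> int" where
  "up s j c x = (if x \<in> chamber s \<and> dec j x \<in> chamber s then c (dec j x) else 0)"

definition down :: "nat \<Rightarrow> nat \<Rightarrow> ((nat \<Rightarrow> int) \<Rightarrow> int) \<Rightarrow> (nat \<Rightarrow> int) \<Rightarrow> int" where
  "down s j c x = (if x \<in> chamber s \<and> inc j x \<in> chamber s then c (inc j x) else 0)"

definition up_below :: "nat \<Rightarrow> ((nat \<Rightarrow> int) \<Rightarrow> int) \<Rightarrow> (nat \<Rightarrow> int) \<Rightarrow> int" where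
  "up_below s c x = (\<Sum>j=1..r. up s j c x)"

definition down_below :: "nat \<Rightarrow> ((nat \<Rightarrow> int) \<Rightarrow> int) \<Rightarrow> (nat \<Rightarrow> int) \<Rightarrow> int" where
  "down_below s c x = (\<Sum>j=1..r. down s j c x)"

text \<open>
The points with \<open>N\<close> boxes in total and \<open>k\<close> boxes in the first row; the empty partition has the
coordinates \<open>r, \<dots>, 0\<close>, hence the two offsets.
\<close>

definition level :: "nat \<Rightarrow> int \<Rightarrow> int \<Rightarrow> (nat \<Rightarrow> int) set" where
  "level s N k = {x \<in> chamber s. x 0 = k + int r \<and> (\<Sum>i\<le>r. x i) = N + (\<Sum>i\<le>r. int i)}"

lemma inc_chamber_iff:
  assumes "x \<in> chamber s" "s \<le> j" "j \<le> r"
  shows "inc j x \<in> chamber s \<longleftrightarrow> j = s \<or> x j + 1 < x (j - 1)"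
proof
  assume a: "inc j x \<in> chamber s"
  show "j = s \<or> x j + 1 < x (j - 1)"
  proof (cases "j = s")
    case False
    then have "s \<le> j - 1" "j - 1 < r" "Suc (j - 1) = j" using assms by auto
    then have "inc j x (Suc (j - 1)) < inc j x (j - 1)" using a unfolding chamber_def by blast
    then show ?thesis using \<open>Suc (j - 1) = j\<close> by (auto split: if_splits)
  qed simp
next
  assume a: "j = s \<or> x j + 1 < x (j - 1)"
  have lt: "\<And>i. s \<le> i \<Longrightarrow> i < r \<Longrightarrow> x (Suc i) < x i" using assms by (auto simp: chamber_def)
  have "inc j x (Suc i) < inc j x i" if "s \<le> i" "i < r" for i
    using lt[OF that] a that by (cases "Suc i = j") auto
  then show "inc j x \<in> chamber s" using assms by (auto simp: chamber_def)
qed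

lemma dec_chamber_iff:
  assumes "x \<in> chamber s" "s \<le> j" "j \<le> r"
  shows "dec j x \<in> chamber s \<longleftrightarrow> (if j = r then 0 < x r else x (Suc j) < x j - 1)"
proof
  assume a: "dec j x \<in> chamber s"
  show "if j = r then 0 < x r else x (Suc j) < x j - 1"
  proof (cases "j = r")
    case False
    then have "dec j x (Suc j) < dec j x j" using a assms unfolding chamber_def by auto
    then show ?thesis using False by auto
  qed (use a in \<open>auto simp: chamber_def\<close>)
next
  assume a: "if j = r then 0 < x r else x (Suc j) < x j - 1"
  have lt: "\<And>i. s \<le> i \<Longrightarrow> i < r \<Longrightarrow> x (Suc i) < x i" using assms by (auto simp: chamber_def)
  have "dec j x (Suc i) < dec j x i" if "s \<le> i" "i < r" for i
    using lt[OF that] a that by (cases "i = j") (auto split: if_splits)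
  then show "dec j x \<in> chamber s" using assms a by (auto simp: chamber_def split: if_splits)
qed

lemma first_free_chamber: "r \<ge> 1 \<Longrightarrow> x(0 := a) \<in> chamber 1 \<longleftrightarrow> x \<in> chamber 1"
  by (auto simp: chamber_def)

lemma chamber_gap: "x \<in> chamber s \<Longrightarrow> s \<le> i \<Longrightarrow> i \<le> j \<Longrightarrow> j \<le> r \<Longrightarrow> x j + int (j - i) \<le> x i"
proof (induction "j - i" arbitrary: j)
  case (Suc d)
  then have "d = j - 1 - i" "i \<le> j - 1" "j - 1 \<le> r" by auto
  then have "x (j - 1) + int (j - 1 - i) \<le> x i" using Suc.hyps(1)[of "j - 1"] Suc.prems by blast
  moreover have "s \<le> j - 1" "j - 1 < r" "Suc (j - 1) = j" using Suc by auto
  then have "x (Suc (j - 1)) < x (j - 1)" using Suc.prems(1) unfolding chamber_def by blast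
  ultimately show ?case using Suc by (auto simp: of_nat_diff)
qed auto

lemma chamber_nonneg: "x \<in> chamber s \<Longrightarrow> s \<le> i \<Longrightarrow> 0 \<le> x i"
  using chamber_gap[of x s i r] by (cases "i \<le> r") (auto simp: chamber_def)

text \<open>
Moving a box from row \<open>j\<close> to row \<open>i\<close> can be done in either order, because the two intermediate points
lie in the chamber under the same condition. This is delicate only for \<open>j = i + 1\<close>.
\<close>

lemma down_up_commute:
  assumes "i \<noteq> j" "s \<le> i" "s \<le> j" "i \<le> r" "j \<le> r"
  shows "down s j (up s i c) x = up s i (down s j c) x"
proof (cases "x \<in> chamber s \<and> dec i (inc j x) \<in> chamber s")
  case True
  define y where "y = dec i (inc j x)"
  have y: "y \<in> chamber s" "y = inc j (dec i x)" "y i = x i - 1" "y j = x j + 1"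
    "\<And>l. l \<noteq> i \<Longrightarrow> l \<noteq> j \<Longrightarrow> y l = x l"
    using True assms by (auto simp: y_def fun_upd_twist)
  have ylt: "\<And>l. s \<le> l \<Longrightarrow> l < r \<Longrightarrow> y (Suc l) < y l" "0 \<le> y r" using y(1) by (auto simp: chamber_def)
  have "inc j x \<in> chamber s \<longleftrightarrow> dec i x \<in> chamber s"
  proof (cases "j = Suc i")
    case True
    then show ?thesis using assms \<open>x \<in> chamber s \<and> _\<close> by (auto simp: inc_chamber_iff dec_chamber_iff)
  next
    case False
    have "j = s \<or> x j + 1 < x (j - 1)"
    proof (cases "j = s")
      case js: False
      then have "s \<le> j - 1" "j - 1 < r" "Suc (j - 1) = j" "j - 1 \<noteq> i" "j - 1 \<noteq> j" using False assms by auto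
      then show ?thesis using ylt(1)[of "j - 1"] y(4) y(5)[of "j - 1"] by simp
    qed simp
    moreover have "if i = r then 0 < x r else x (Suc i) < x i - 1"
      using ylt(1)[of i] ylt(2) y False assms by auto
    ultimately show ?thesis using assms True by (simp add: inc_chamber_iff dec_chamber_iff)
  qed
  then show ?thesis using True y assms unfolding up_def down_def y_def by (simp add: fun_upd_twist)
next
  case False
  then show ?thesis using assms unfolding up_def down_def by (auto simp: fun_upd_twist)
qed

lemma down_up_diagonal: "j \<le> r \<Longrightarrow> down s j (up s j c) x = (if x \<in> chamber s \<and> inc j x \<in> chamber s then c x else 0)"
  unfolding up_def down_def by auto

lemma up_down_diagonal: "j \<le> r \<Longrightarrow> up s j (down s j c) x = (if x \<in> chamber s \<and> dec j x \<in> chamber s then c x else 0)"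
  unfolding up_def down_def by auto

lemma down_up_first: "s \<le> r \<Longrightarrow> down s s (up s s c) x = (if x \<in> chamber s then c x else 0)"
  by (auto simp: down_up_diagonal inc_chamber_iff)

text \<open>
A box may be added to row \<open>j + 1\<close> exactly if one may be removed from row \<open>j\<close>. This pairing of the
diagonal terms is the whole content of the relation \<open>D U - U D = 1\<close> in Young's lattice.
\<close>

lemma down_up_next: "s \<le> j \<Longrightarrow> j < r \<Longrightarrow> down s (Suc j) (up s (Suc j) c) x = up s j (down s j c) x"
  by (auto simp: down_up_diagonal up_down_diagonal inc_chamber_iff dec_chamber_iff)

lemma down_sum: "down s j (\<lambda>x. \<Sum>a\<in>A. c a x) x = (\<Sum>a\<in>A. down s j (c a) x)"
  unfolding down_def by auto

lemma up_sum: "up s j (\<lambda>x. \<Sum>a\<in>A. c a x) x = (\<Sum>a\<in>A. up s j (c a) x)"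
  unfolding up_def by auto

lemma up_below_sum: "up_below s (\<lambda>x. \<Sum>a\<in>A. c a x) x = (\<Sum>a\<in>A. up_below s (c a) x)"
  unfolding up_below_def up_sum by (rule sum.swap)

text \<open>
Off the diagonal everything commutes, and along the diagonal \<open>down_up_next\<close> makes the sum telescope. The
last term is an effect of admitting only finitely many rows; it vanishes when there are fewer boxes
than rows.
\<close>

lemma down_below_up_below:
  assumes "s \<le> 1" "1 \<le> r"
  shows "down_below s (up_below s c) x =
    up_below s (down_below s c) x + down s 1 (up s 1 c) x - up s r (down s r c) x"
proof -
  \<comment> \<open>The commutators, and the diagonal terms indexed so that each commutator is a
    difference of neighbours.\<close>
  define g where "g j i = down s j (up s i c) x - up s i (down s j c) x" for j i
  define h where "h j = (if j = 0 then down s 1 (up s 1 c) x else up s j (down s j c) x)" for j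
  have "down_below s (up_below s c) x = (\<Sum>j=1..r. \<Sum>i=1..r. down s j (up s i c) x)"
    unfolding down_below_def up_below_def[abs_def] by (simp add: down_sum)
  moreover have "up_below s (down_below s c) x = (\<Sum>j=1..r. \<Sum>i=1..r. up s i (down s j c) x)"
    unfolding up_below_def down_below_def[abs_def] by (simp add: up_sum) (rule sum.swap)
  ultimately have "down_below s (up_below s c) x - up_below s (down_below s c) x = (\<Sum>j=1..r. \<Sum>i=1..r. g j i)"
    by (simp add: g_def sum_subtractf)
  also have "\<dots> = (\<Sum>j=1..r. g j j)"
  proof (rule sum.cong[OF refl])
    fix j assume j: "j \<in> {1..r}"
    have "(\<Sum>i=1..r. g j i) = (\<Sum>i\<in>{j}. g j i)"
      using j assms by (intro sum.mono_neutral_right) (auto simp: g_def down_up_commute)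
    then show "(\<Sum>i=1..r. g j i) = g j j" by simp
  qed
  also have "\<dots> = (\<Sum>j<r. g (Suc j) (Suc j))" by (simp add: sum.atLeast1_atMost_eq)
  also have "\<dots> = (\<Sum>j<r. h j - h (Suc j))"
    using assms by (intro sum.cong) (auto simp: g_def h_def down_up_next)
  also have "\<dots> = h 0 - h r" by (rule sum_lessThan_telescope')
  finally show ?thesis using assms by (simp add: h_def)
qed

lemma finite_level:
  assumes "s \<le> 1" shows "finite (level s N k)"
proof -
  \<comment> \<open>All coordinates but the first are nonnegative, so each is at most their sum, which
    the level fixes.\<close>
  define B where "B = \<bar>k + int r\<bar> + \<bar>N + (\<Sum>i\<le>r. int i) - (k + int r)\<bar>"
  have "level s N k \<subseteq> {x. \<forall>i. (i \<in> {..r} \<longrightarrow> x i \<in> {-B..B}) \<and> (i \<notin> {..r} \<longrightarrow> x i = 0)}"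
  proof (intro subsetI CollectI allI conjI impI)
    fix x i assume x: "x \<in> level s N k"
    show "x i = 0" if "i \<notin> {..r}" using x that by (auto simp: level_def chamber_def)
    assume i: "i \<in> {..r}"
    show "x i \<in> {-B..B}"
    proof (cases "i = 0")
      case True
      then show ?thesis using x by (auto simp: level_def B_def)
    next
      case False
      have "(\<Sum>l\<le>r. x l) = x 0 + (\<Sum>l\<in>{1..r}. x l)"
        by (subst sum.remove[of _ 0]) (auto intro!: sum.cong)
      moreover have nn: "0 \<le> x l" if "l \<ge> 1" for l
        using x assms that by (intro chamber_nonneg[of x s]) (auto simp: level_def)
      moreover have "x i \<le> (\<Sum>l\<in>{1..r}. x l)"
        using i False nn by (intro member_le_sum) auto
      ultimately have "x i \<le> B" using x by (auto simp: level_def B_def)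
      moreover have "0 \<le> B" by (simp add: B_def)
      moreover have "0 \<le> x i" using nn False by auto
      ultimately show ?thesis by simp
    qed
  qed
  then show ?thesis by (rule finite_subset) (intro finite_set_of_finite_funs, auto)
qed

lemma inc_level_iff: "j \<le> r \<Longrightarrow> x \<in> chamber s \<Longrightarrow> inc j x \<in> chamber s \<Longrightarrow>
    inc j x \<in> level s (N + 1) (if j = 0 then k + 1 else k) \<longleftrightarrow> x \<in> level s N k"
  unfolding level_def by (auto simp: sum_fun_upd simp del: fun_upd_apply) auto

lemma up_down_adjoint:
  assumes "s \<le> 1" "j \<le> r"
  shows "(\<Sum>x\<in>level s (N + 1) (if j = 0 then k + 1 else k). up s j c x * d x) =
    (\<Sum>x\<in>level s N k. c x * down s j d x)"
proof -
  let ?X = "level s (N + 1) (if j = 0 then k + 1 else k)" and ?Y = "level s N k"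
  have "(\<Sum>x\<in>?X. up s j c x * d x) = (\<Sum>x\<in>{x \<in> ?X. dec j x \<in> chamber s}. up s j c x * d x)"
    using finite_level[OF assms(1)] by (intro sum.mono_neutral_right) (auto simp: up_def)
  also have "\<dots> = (\<Sum>y\<in>{y \<in> ?Y. inc j y \<in> chamber s}. c y * down s j d y)"
  proof (rule sum.reindex_bij_witness[of _ "inc j" "dec j"], goal_cases)
    case (1 x) then show ?case by simp
  next
    case (2 x)
    then have "inc j (dec j x) \<in> ?X" "x \<in> chamber s" by (auto simp: level_def)
    then have "dec j x \<in> ?Y" using 2 assms inc_level_iff[of j "dec j x" s N k] by simp
    then show ?case using \<open>x \<in> chamber s\<close> by simp
  next
    case (3 y) then show ?case by simp
  next
    case (4 y)
    then have "y \<in> chamber s" by (simp add: level_def)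
    then show ?case using 4 assms inc_level_iff[of j y s N k] by simp
  next
    case (5 x) 
    then have "x \<in> chamber s" by (simp add: level_def)
    then show ?case using 5 by (auto simp: up_def down_def)
  qed
  also have "\<dots> = (\<Sum>x\<in>?Y. c x * down s j d x)"
    using finite_level[OF assms(1)] by (intro sum.mono_neutral_left) (auto simp: down_def)
  finally show ?thesis .
qed

end

section \<open>Signed lattice walks\<close>

lemma sum_lessThan_card_le: "finite A \<Longrightarrow> (\<Sum>i<card A. i) \<le> \<Sum>A" for A :: "nat set"
proof (induction rule: finite_linorder_max_induct)
  case (insert b A)
  have "A \<subseteq> {..<b}" using insert by auto
  then have "card A \<le> b" using card_mono[of "{..<b}" A] by simp
  then show ?case using insert by auto
qed simp

lemma sum_ge_of_inj:
  fixes x :: "nat \<Rightarrow> int"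
  assumes "inj_on x {..r}" "\<And>i. i \<le> r \<Longrightarrow> a \<le> x i"
  shows "(\<Sum>i\<le>r. int i + a) \<le> (\<Sum>i\<le>r. x i)"
proof -
  define f where "f i = nat (x i - a)" for i
  have inj: "inj_on f {..r}"
  proof (rule inj_onI)
    fix i j assume ij: "i \<in> {..r}" "j \<in> {..r}" "f i = f j"
    then have "x i = x j" using assms(2)[of i] assms(2)[of j] by (simp add: f_def eq_nat_nat_iff)
    then show "i = j" using ij assms(1) by (auto simp: inj_on_def)
  qed
  have "(\<Sum>i\<le>r. i) \<le> \<Sum>(f ` {..r})"
    using sum_lessThan_card_le[of "f ` {..r}"] card_image[OF inj] by (simp add: lessThan_Suc_atMost)
  also have "\<dots> = (\<Sum>i\<le>r. f i)" using inj by (simp add: sum.reindex)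
  finally have "int (\<Sum>i\<le>r. i) \<le> int (\<Sum>i\<le>r. f i)" by (simp only: of_nat_le_iff)
  moreover have "int (\<Sum>i\<le>r. f i) = (\<Sum>i\<le>r. x i - a)"
    unfolding of_nat_sum using assms(2) by (intro sum.cong) (auto simp: f_def)
  ultimately show ?thesis by (simp add: sum.distrib sum_subtractf)
qed

context
  fixes r :: nat
begin

text \<open>
For the points that are permutations of \<open>r, \<dots>, 0\<close>, the permutation that relates them to the empty
partition.
\<close>

definition rank_perm :: "(nat \<Rightarrow> int) \<Rightarrow> nat \<Rightarrow> nat" where
  "rank_perm x i = (if i \<le> r then nat (int r - x i) else i)"

text \<open>
\<open>walks n x\<close> counts the walks of \<open>n\<close> unit steps to \<open>x\<close>, without any restriction, that start at a
permutation of the empty partition, weighted by the sign of that permutation. By the reflection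
principle this is the number of standard Young tableaux if \<open>x\<close> is a partition of \<open>n\<close>; here that fact
enters as \<open>walks_Suc_chamber\<close>, since the recursion inside the chamber is all that is used.
\<close>

primrec walks :: "nat \<Rightarrow> (nat \<Rightarrow> int) \<Rightarrow> int" where
  "walks 0 x = (if (\<forall>i\<le>r. 0 \<le> x i \<and> x i \<le> int r) \<and> rank_perm x permutes {..r} then sign (rank_perm x) else 0)"
| "walks (Suc n) x = (\<Sum>j\<le>r. walks n (dec j x))"

lemma sum_transpose:
  assumes "i \<le> r" "j \<le> r"
  shows "(\<Sum>l\<le>r. f (transpose i j l)) = (\<Sum>l\<le>r. f l)"
  using sum.permute[OF permutes_swap_id[of i "{..r}" j], of f] assms by (simp add: comp_def)

lemma walks_transpose:
  assumes "i \<le> r" "j \<le> r" "i \<noteq> j"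
  shows "walks n (x \<circ> transpose i j) = - walks n x"
proof (induction n arbitrary: x)
  case 0
  let ?t = "transpose i j"
  have t: "?t permutes {..r}" using assms by (intro permutes_swap_id) auto
  have tr: "?t l \<le> r \<longleftrightarrow> l \<le> r" for l using permutes_in_image[OF t, of l] by simp
  have rk: "rank_perm (x \<circ> ?t) = rank_perm x \<circ> ?t"
    using tr by (auto simp: rank_perm_def fun_eq_iff transpose_def assms)
  have rng: "(\<forall>l\<le>r. 0 \<le> (x \<circ> ?t) l \<and> (x \<circ> ?t) l \<le> int r) \<longleftrightarrow> (\<forall>l\<le>r. 0 \<le> x l \<and> x l \<le> int r)"
    (is "?A \<longleftrightarrow> ?B")
  proof
    assume A: ?A
    show ?B
    proof (intro allI impI)
      fix l assume "l \<le> r"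
      then show "0 \<le> x l \<and> x l \<le> int r" using spec[OF A, of "?t l"] tr by simp
    qed
  qed (use tr in auto)
  have pt: "rank_perm x \<circ> ?t permutes {..r} \<longleftrightarrow> rank_perm x permutes {..r}"
  proof
    assume "rank_perm x \<circ> ?t permutes {..r}"
    from permutes_compose[OF t this] show "rank_perm x permutes {..r}" by (simp add: comp_assoc)
  qed (rule permutes_compose[OF t])
  have "sign (rank_perm x \<circ> ?t) = - sign (rank_perm x)" if "rank_perm x permutes {..r}"
    using that t assms by (subst sign_compose) (auto intro: permutes_imp_permutation simp: sign_swap_id)
  then show ?case unfolding walks.simps rk rng pt by auto
next
  case (Suc n)
  let ?t = "transpose i j"
  have "dec l (x \<circ> ?t) = dec (?t l) x \<circ> ?t" for l
    by (auto simp: fun_eq_iff transpose_def)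
  then have "walks (Suc n) (x \<circ> ?t) = (\<Sum>l\<le>r. walks n (dec (?t l) x \<circ> ?t))" by simp
  also have "\<dots> = (\<Sum>l\<le>r. - walks n (dec (?t l) x))" unfolding Suc ..
  also have "\<dots> = (\<Sum>l\<le>r. - walks n (dec l x))" using sum_transpose[OF assms(1,2)] .
  finally show ?case by (simp only: sum_negf walks.simps(2))
qed

lemma walks_eq_0_if_coincident: "i \<le> r \<Longrightarrow> j \<le> r \<Longrightarrow> i \<noteq> j \<Longrightarrow> x i = x j \<Longrightarrow> walks n x = 0"
proof -
  assume a: "i \<le> r" "j \<le> r" "i \<noteq> j" "x i = x j"
  then have "x \<circ> transpose i j = x" by (auto simp: fun_eq_iff transpose_def)
  then show ?thesis using walks_transpose[OF a(1-3), of n x] by simp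
qed

lemma walks_eq_0_if_negative: "i \<le> r \<Longrightarrow> x i < 0 \<Longrightarrow> walks n x = 0"
proof (induction n arbitrary: x)
  case (Suc n)
  then have "walks n (dec j x) = 0" for j by (intro Suc.IH) auto
  then show ?case by simp
qed auto

lemma walks_sum: "walks n x \<noteq> 0 \<Longrightarrow> (\<Sum>i\<le>r. x i) = int n + (\<Sum>i\<le>r. int i)"
proof (induction n arbitrary: x)
  case 0
  then have p: "rank_perm x permutes {..r}" and b: "\<forall>i\<le>r. 0 \<le> x i \<and> x i \<le> int r"
    by (auto split: if_splits)
  have "(\<Sum>i\<le>r. x i) = (\<Sum>i\<le>r. int (r - rank_perm x i))"
    using b by (intro sum.cong) (auto simp: rank_perm_def)
  also have "\<dots> = (\<Sum>i\<le>r. int (r - i))"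
    using sum.permute[OF p, of "\<lambda>i. int (r - i)"] by (simp add: comp_def)
  also have "\<dots> = (\<Sum>i\<le>r. int i)"
    by (rule sum.reindex_bij_witness[of _ "\<lambda>i. r - i" "\<lambda>i. r - i"]) auto
  finally show ?case by simp
next
  case (Suc n)
  then have "(\<Sum>j\<le>r. walks n (dec j x)) \<noteq> 0" by simp
  then obtain j where "j \<in> {..r}" "walks n (dec j x) \<noteq> 0"
    by (rule sum.not_neutral_contains_not_neutral)
  then show ?case using Suc.IH[of "dec j x"] by (simp add: sum_fun_upd del: fun_upd_apply)
qed

text \<open>
The counterpart of \<open>\<Sum> f(\<lambda>) = n f(\<kappa>)\<close>, the sum over all \<open>\<lambda>\<close> that cover \<open>\<kappa>\<close>. Steps forward and backward
commute, except that a point with a negative coordinate cannot be reached. So each zero coordinate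
of \<open>x\<close> contributes one extra term, and as long as \<open>n \<le> r\<close> there is precisely one zero coordinate
wherever \<open>walks n\<close> does not vanish.
\<close>

lemma sum_walks_inc:
  assumes "\<forall>i\<le>r. 0 \<le> x i" "n \<le> r + 1"
  shows "(\<Sum>j\<le>r. walks n (inc j x)) = int n * walks (n - 1) x"
  using assms
proof (induction n arbitrary: x)
  case 0
  have "(\<Sum>j\<le>r. walks 0 (inc j x)) = 0"
  \<comment> \<open>Equal coordinates make the terms cancel in pairs; distinct nonnegative ones add up to
    at least the sum at the starting points, so one more step overshoots it.\<close>
  proof (cases "inj_on x {..r}")
    case False
    then obtain i j where ij: "i \<le> r" "j \<le> r" "i \<noteq> j" "x i = x j" by (auto simp: inj_on_def)
    let ?t = "transpose i j"
    have inc: "inc (?t l) x = inc l x \<circ> ?t" for l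
      using ij by (auto simp: fun_eq_iff transpose_def)
    have "(\<Sum>l\<le>r. walks 0 (inc l x)) = (\<Sum>l\<le>r. walks 0 (inc (?t l) x))"
      using sum_transpose[OF ij(1,2), of "\<lambda>l. walks 0 (inc l x)"] by simp
    also have "\<dots> = - (\<Sum>l\<le>r. walks 0 (inc l x))"
      unfolding inc walks_transpose[OF ij(1-3)] by (rule sum_negf)
    finally show ?thesis by simp
  next
    case True
    have "walks 0 (inc j x) = 0" if "j \<le> r" for j
    proof (rule ccontr)
      assume "walks 0 (inc j x) \<noteq> 0"
      from walks_sum[OF this] sum_ge_of_inj[OF True, of 0] 0 that
      show False by (auto simp: sum_fun_upd simp del: fun_upd_apply)
    qed
    then show ?thesis by (intro sum.neutral) auto
  qed
  then show ?case by (simp only: of_nat_0 mult_zero_left)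
next
  case (Suc n)
  define Z where "Z = {i. i \<le> r \<and> x i = 0}"
  have inner: "(\<Sum>j\<le>r. walks n (inc j (dec i x))) =
      int n * walks (n - 1) (dec i x) + (if i \<in> Z then walks n x else 0)" if i: "i \<le> r" for i
  proof (cases "x i = 0")
    case False
    then have "0 < x i" using Suc.prems(1) i by (simp add: order_less_le)
    then have "\<forall>l\<le>r. 0 \<le> dec i x l" using Suc.prems(1) by simp
    then have "(\<Sum>j\<le>r. walks n (inc j (dec i x))) = int n * walks (n - 1) (dec i x)"
      using Suc.prems(2) by (intro Suc.IH) auto
    then show ?thesis using False unfolding Z_def by (simp only: mem_Collect_eq if_False simp_thms add_0_right)
  next
    case True
    have "walks n (inc j (dec i x)) = 0" if "j \<noteq> i" for j
      using i that True by (intro walks_eq_0_if_negative[of i]) auto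
    then have "(\<Sum>j\<le>r. walks n (inc j (dec i x))) = (\<Sum>j\<in>{i}. walks n (inc j (dec i x)))"
      using i by (intro sum.mono_neutral_right) auto
    moreover have "walks (n - 1) (dec i x) = 0"
      using i True by (intro walks_eq_0_if_negative[of i]) auto
    moreover have "inc i (dec i x) = x" by simp
    ultimately show ?thesis using i True unfolding Z_def by (simp del: fun_upd_apply)
  qed
  have "(\<Sum>j\<le>r. walks (Suc n) (inc j x)) = (\<Sum>j\<le>r. \<Sum>i\<le>r. walks n (dec i (inc j x)))"
    by (simp only: walks.simps(2))
  also have "\<dots> = (\<Sum>i\<le>r. \<Sum>j\<le>r. walks n (dec i (inc j x)))" by (rule sum.swap)
  also have "\<dots> = (\<Sum>i\<le>r. \<Sum>j\<le>r. walks n (inc j (dec i x)))"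
  proof (intro sum.cong refl)
    fix i j show "walks n (dec i (inc j x)) = walks n (inc j (dec i x))"
      by (cases "i = j") (simp_all add: fun_upd_twist)
  qed
  also have "\<dots> = (\<Sum>i\<le>r. int n * walks (n - 1) (dec i x) + (if i \<in> Z then walks n x else 0))"
    using inner by (intro sum.cong) auto
  also have "\<dots> = int n * (\<Sum>i\<le>r. walks (n - 1) (dec i x)) + int (card Z) * walks n x"
  proof -
    have "(\<Sum>i\<le>r. if i \<in> Z then walks n x else 0) = (\<Sum>i\<in>Z. walks n x)"
      by (simp add: sum.If_cases Z_def) (auto intro!: arg_cong[of _ _ card])
    then show ?thesis by (simp add: sum.distrib sum_distrib_left)
  qed
  also have "int n * (\<Sum>i\<le>r. walks (n - 1) (dec i x)) = int n * walks n x"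
    by (cases n) auto
  also have "int (card Z) * walks n x = walks n x"
  proof (cases "walks n x = 0")
    case False
    have inj: "inj_on x {..r}"
      using False walks_eq_0_if_coincident unfolding inj_on_def by (metis atMost_iff)
    \<comment> \<open>Otherwise the distinct positive coordinates would add up to at least \<open>1 +
      \<dots> + (r + 1)\<close>.\<close>
    have "\<exists>i. i \<in> Z"
    proof (rule ccontr)
      assume "\<nexists>i. i \<in> Z"
      then have "\<And>i. i \<le> r \<Longrightarrow> 1 \<le> x i" using Suc.prems(1) by (metis (mono_tags) Z_def mem_Collect_eq int_one_le_iff_zero_less order_less_le)
      from sum_ge_of_inj[OF inj this] walks_sum[OF False] Suc.prems show False
        by (simp add: sum.distrib)
    qed
    then obtain i where "i \<in> Z" by blast
    then have "Z = {i}" using inj by (auto simp: Z_def inj_on_def)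
    then show ?thesis by simp
  qed simp
  finally show ?case by (simp add: algebra_simps)
qed

text \<open>
Points outside the chamber but one step away from it have two equal coordinates or a negative one, so
restricting a step to the chamber loses nothing.
\<close>

lemma up_walks:
  assumes "s \<le> 1" "1 \<le> r" "j \<le> r" "x \<in> chamber r s"
  shows "up r s j (walks n) x = walks n (dec j x)"
proof (cases "dec j x \<in> chamber r s")
  case False
  then have sj: "s \<le> j" using assms first_free_chamber[of r] by (cases "s = 1 \<and> j = 0") auto
  have "walks n (dec j x) = 0"
  proof (cases "j = r")
    case True
    then have "x r \<le> 0" using False dec_chamber_iff[OF assms(4) sj assms(3)] by auto
    then show ?thesis using True by (intro walks_eq_0_if_negative[of r]) auto
  next
    case j: False
    then have "x j - 1 \<le> x (Suc j)" using False dec_chamber_iff[OF assms(4) sj assms(3)] by auto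
    moreover have "x (Suc j) < x j" using assms sj j by (auto simp: chamber_def)
    ultimately show ?thesis using j assms by (intro walks_eq_0_if_coincident[of j "Suc j"]) auto
  qed
  then show ?thesis using False by (simp add: up_def)
qed (use assms in \<open>simp add: up_def\<close>)

lemma walks_Suc_chamber:
  assumes "s \<le> 1" "1 \<le> r" "x \<in> chamber r s"
  shows "walks (Suc n) x = up r s 0 (walks n) x + up_below r s (walks n) x"
proof -
  have "{..r} = insert 0 {1..r}" by auto
  then have "walks (Suc n) x = walks n (dec 0 x) + (\<Sum>j=1..r. walks n (dec j x))" by simp
  then show ?thesis unfolding up_below_def using assms by (simp add: up_walks)
qed

lemma down_walks:
  assumes "1 \<le> r" "x \<in> chamber r 1" "0 \<le> x 0" "n \<le> r + 1"
  shows "down r 1 0 (walks n) x + down_below r 1 (walks n) x = int n * walks (n - 1) x"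
proof -
  have "down r 1 j (walks n) x = walks n (inc j x)" if j: "j \<le> r" for j
  proof (cases "inc j x \<in> chamber r 1")
    case False
    then have j1: "1 \<le> j" using assms first_free_chamber[of r] by (cases j) auto
    then have "x (j - 1) \<le> x j + 1" "2 \<le> j" using False inc_chamber_iff[OF assms(2) j1 j] j1 by auto
    moreover have "x j < x (j - 1)"
    proof -
      have "1 \<le> j - 1" "j - 1 \<le> j" using \<open>2 \<le> j\<close> by auto
      from chamber_gap[OF assms(2) this j] show ?thesis using \<open>2 \<le> j\<close> by auto
    qed
    ultimately have "walks n (inc j x) = 0"
      using j by (intro walks_eq_0_if_coincident[of "j - 1" j]) auto
    then show ?thesis using False by (simp add: down_def)
  qed (use assms in \<open>simp add: down_def\<close>)
  then have "down r 1 0 (walks n) x + down_below r 1 (walks n) x = walks n (inc 0 x) + (\<Sum>j=1..r. walks n (inc j x))"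
    by (simp add: down_below_def)
  also have "\<dots> = (\<Sum>j\<le>r. walks n (inc j x))"
  proof -
    have "{..r} = insert 0 {1..r}" by auto
    then show ?thesis by simp
  qed
  also have "\<dots> = int n * walks (n - 1) x"
  proof (rule sum_walks_inc[OF _ assms(4)], intro allI impI)
    fix i show "0 \<le> x i" using assms chamber_nonneg[of x r 1 i] by (cases i) auto
  qed
  finally show ?thesis .
qed

end

section \<open>Tableaux with a prescribed first row\<close>

lemma distinct_of_decreasing: "sorted_wrt (>) vs \<Longrightarrow> distinct vs" for vs :: "nat list"
  by (induction vs) auto

context
  fixes r :: nat
begin

lemma adjoint_below:
  assumes "s \<le> 1"
  shows "(\<Sum>x\<in>level r s (N + 1) k. up_below r s c x * d x) = (\<Sum>x\<in>level r s N k. c x * down_below r s d x)"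
proof -
  have "(\<Sum>x\<in>level r s (N + 1) k. up_below r s c x * d x) = (\<Sum>j=1..r. \<Sum>x\<in>level r s (N + 1) k. up r s j c x * d x)"
    unfolding up_below_def sum_distrib_right by (rule sum.swap)
  also have "\<dots> = (\<Sum>j=1..r. \<Sum>x\<in>level r s N k. c x * down r s j d x)"
  proof (rule sum.cong[OF refl])
    fix j assume "j \<in> {1..r}"
    then show "(\<Sum>x\<in>level r s (N + 1) k. up r s j c x * d x) = (\<Sum>x\<in>level r s N k. c x * down r s j d x)"
      using up_down_adjoint[OF assms, where r = r and j = j and N = N and k = k and c = c and d = d] by simp
  qed
  also have "\<dots> = (\<Sum>x\<in>level r s N k. c x * down_below r s d x)"
    unfolding down_below_def sum_distrib_left by (rule sum.swap)
  finally show ?thesis .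
qed

lemma adjoint_first:
  assumes "s \<le> 1"
  shows "(\<Sum>x\<in>level r s (N + 1) k. up r s 0 c x * d x) = (\<Sum>x\<in>level r s N (k - 1). c x * down r s 0 d x)"
  using up_down_adjoint[OF assms, where r = r and j = 0 and N = N and k = "k - 1" and c = c and d = d] by simp

lemma chamber_sum_ge:
  assumes "x \<in> chamber r 0"
  shows "(\<Sum>i\<le>r. int i + x r) \<le> (\<Sum>i\<le>r. x i)"
proof -
  have "(\<Sum>i\<le>r. int i + x r) = (\<Sum>i\<le>r. int (r - i) + x r)"
    by (rule sum.reindex_bij_witness[of _ "\<lambda>i. r - i" "\<lambda>i. r - i"]) auto
  also have "\<dots> \<le> (\<Sum>i\<le>r. x i)"
    using chamber_gap[OF assms, of _ r] by (intro sum_mono) (auto simp: add.commute)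
  finally show ?thesis .
qed

definition vacuum :: "nat \<Rightarrow> int" where
  "vacuum i = (if i \<le> r then int (r - i) else 0)"

text \<open>
The coefficient at \<open>x\<close> is the number of standard tableaux of shape \<open>x\<close> that are filled with the letters
of the list, which is decreasing in all uses, and whose first row consists of the letters in \<open>R\<close>. The
head of the list is the largest letter, hence the box that was added last.
\<close>

primrec tableaux :: "nat list \<Rightarrow> nat set \<Rightarrow> (nat \<Rightarrow> int) \<Rightarrow> int" where
  "tableaux [] R = (\<lambda>x. if x = vacuum then 1 else 0)"
| "tableaux (v # vs) R = (if v \<in> R then up r 0 0 (tableaux vs R) else up_below r 0 (tableaux vs R))"

lemma tableaux_cong: "R \<inter> set vs = R' \<inter> set vs \<Longrightarrow> tableaux vs R = tableaux vs R'"
proof (induction vs)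
  case (Cons v vs)
  then have "v \<in> R \<longleftrightarrow> v \<in> R'" "R \<inter> set vs = R' \<inter> set vs" by auto
  then show ?case using Cons.IH by simp
qed simp

lemma vacuum_level: "vacuum \<in> level r 0 0 0"
proof -
  have "(\<Sum>i\<le>r. vacuum i) = (\<Sum>i\<le>r. int (r - i))" by (simp add: vacuum_def)
  also have "\<dots> = (\<Sum>i\<le>r. int i)"
    by (rule sum.reindex_bij_witness[of _ "\<lambda>i. r - i" "\<lambda>i. r - i"]) auto
  finally show ?thesis by (auto simp: level_def chamber_def vacuum_def)
qed

lemma up_level:
  assumes "up r 0 j c x \<noteq> 0" "j \<le> r" "\<And>y. c y \<noteq> 0 \<Longrightarrow> y \<in> level r 0 N k"
  shows "x \<in> level r 0 (N + 1) (if j = 0 then k + 1 else k)"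
proof -
  have x: "x \<in> chamber r 0" "dec j x \<in> chamber r 0" "c (dec j x) \<noteq> 0"
    using assms(1) by (auto simp: up_def split: if_splits)
  have "inc j (dec j x) = x" by simp
  then show ?thesis using inc_level_iff[OF assms(2) x(2), of N k] assms(3)[OF x(3)] x(1) by simp
qed

lemma tableaux_level:
  "distinct vs \<Longrightarrow> tableaux vs R x \<noteq> 0 \<Longrightarrow> x \<in> level r 0 (int (length vs)) (int (card (R \<inter> set vs)))"
proof (induction vs arbitrary: x)
  case Nil
  then show ?case using vacuum_level by (auto split: if_splits)
next
  case (Cons v vs)
  have IH: "y \<in> level r 0 (int (length vs)) (int (card (R \<inter> set vs)))" if "tableaux vs R y \<noteq> 0" for y
    using Cons that by auto
  show ?case
  proof (cases "v \<in> R")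
    case True
    then have "up r 0 0 (tableaux vs R) x \<noteq> 0" using Cons.prems by simp
    from up_level[OF this _ IH] show ?thesis using True Cons.prems by (simp add: add.commute)
  next
    case False
    then have "(\<Sum>j=1..r. up r 0 j (tableaux vs R) x) \<noteq> 0"
      using Cons.prems by (simp add: up_below_def)
    then obtain j where j: "j \<in> {1..r}" "up r 0 j (tableaux vs R) x \<noteq> 0"
      by (rule sum.not_neutral_contains_not_neutral)
    from up_level[OF j(2) _ IH] show ?thesis using False j(1) by (simp add: add.commute)
  qed
qed

lemma tableaux_Nil_down: "j \<le> r \<Longrightarrow> down r 0 j (tableaux [] R) x = 0"
proof (rule ccontr)
  assume j: "j \<le> r" and "down r 0 j (tableaux [] R) x \<noteq> 0"
  then have x: "x \<in> chamber r 0" "inc j x = vacuum" by (auto simp: down_def split: if_splits)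
  then have "(\<Sum>i\<le>r. x i) + 1 = (\<Sum>i\<le>r. int i)"
    using vacuum_level j by (simp add: level_def sum_fun_upd flip: x(2) del: fun_upd_apply)
  moreover have "(\<Sum>i\<le>r. int i) \<le> (\<Sum>i\<le>r. int i + x r)"
    using x(1) by (intro sum_mono) (auto simp: chamber_def)
  ultimately show False using chamber_sum_ge[OF x(1)] by linarith
qed

lemma tableaux_chamber: "x \<notin> chamber r 0 \<Longrightarrow> distinct vs \<Longrightarrow> tableaux vs R x = 0"
  using tableaux_level[of vs R x] by (auto simp: level_def)

text \<open>
Since \<open>down r 0 0\<close> commutes with all additions below the first row, it cancels the topmost addition to
the first row, which belongs to the largest letter of \<open>R\<close>.
\<close>

lemma down_first_tableaux:
  assumes "sorted_wrt (>) vs" "R \<subseteq> set vs"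
  shows "down r 0 0 (tableaux vs R) = (if R = {} then (\<lambda>_. 0) else tableaux (removeAll (Max R) vs) (R - {Max R}))"
  using assms
proof (induction vs arbitrary: R)
  case Nil
  then show ?case using tableaux_Nil_down[of 0] by (auto simp: fun_eq_iff)
next
  case (Cons v vs)
  have d: "distinct vs" "v \<notin> set vs" using distinct_of_decreasing[OF Cons.prems(1)] by auto
  show ?case
  proof (cases "v \<in> R")
    case True
    have "Max R = v" using Cons.prems True finite_subset[OF Cons.prems(2)]
      by (intro Max_eqI) (auto simp: le_less)
    moreover have "down r 0 0 (up r 0 0 (tableaux vs R)) = tableaux vs R"
      using d tableaux_chamber by (auto simp: fun_eq_iff down_up_first)
    moreover have "tableaux vs R = tableaux vs (R - {v})" using d by (intro tableaux_cong) auto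
    ultimately show ?thesis using True d by auto
  next
    case False
    then have R: "R \<subseteq> set vs" using Cons.prems by auto
    have "down r 0 0 (up_below r 0 (tableaux vs R)) x = up_below r 0 (down r 0 0 (tableaux vs R)) x" for x
      unfolding up_below_def[abs_def] by (simp add: down_sum down_up_commute)
    then have "down r 0 0 (tableaux (v # vs) R) = up_below r 0 (down r 0 0 (tableaux vs R))"
      using False by (auto simp: fun_eq_iff)
    also have "\<dots> = up_below r 0 (if R = {} then (\<lambda>_. 0) else tableaux (removeAll (Max R) vs) (R - {Max R}))"
      using Cons R by simp
    also have "\<dots> = (if R = {} then (\<lambda>_. 0) else tableaux (removeAll (Max R) (v # vs)) (R - {Max R}))"
    proof (cases "R = {}")
      case True
      then show ?thesis by (auto simp: up_below_def up_def fun_eq_iff)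
    next
      case ne: False
      have "Max R \<in> R" using ne R finite_subset by (intro Max_in) auto
      then have "Max R \<noteq> v" using False by auto
      then show ?thesis using ne False by auto
    qed
    finally show ?thesis .
  qed
qed

lemma up_down_last_tableaux:
  assumes "distinct vs" "length vs \<le> r"
  shows "up r 0 r (down r 0 r (tableaux vs R)) x = 0"
proof (rule ccontr)
  assume "\<not> ?thesis"
  then have x: "x \<in> chamber r 0" "dec r x \<in> chamber r 0" "tableaux vs R x \<noteq> 0"
    by (auto simp: up_down_diagonal split: if_splits)
  then have "1 \<le> x r" using dec_chamber_iff[OF x(1), of r] by simp
  then have "(\<Sum>i\<le>r. int i + 1) \<le> (\<Sum>i\<le>r. int i + x r)" by (intro sum_mono) auto
  also have "\<dots> \<le> (\<Sum>i\<le>r. x i)" by (rule chamber_sum_ge[OF x(1)])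
  also have "\<dots> = int (length vs) + (\<Sum>i\<le>r. int i)"
    using tableaux_level[OF assms(1) x(3)] by (simp add: level_def)
  finally show False using assms(2) by (simp add: sum.distrib)
qed

lemma reverse_bumps_insert_in:
  assumes "v \<in> R" "\<forall>w\<in>V. w < v" "R \<subseteq> insert v V"
  shows "reverse_bumps (insert v V) R = reverse_bumps V (R - {v})"
  using assms by (fastforce simp: reverse_bumps_def)

lemma reverse_bumps_insert_notin:
  assumes "v \<notin> R" "\<forall>w\<in>V. w < v" "R \<subseteq> V" "finite V"
  shows "reverse_bumps (insert v V) R = reverse_bumps V R \<union> (if R = {} then {} else {(Max R, v)})"
proof -
  have fR: "finite R" using assms finite_subset by blast
  have "(w, v) \<in> reverse_bumps (insert v V) R \<longleftrightarrow> R \<noteq> {} \<and> w = Max R" for w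
  proof
    assume w: "(w, v) \<in> reverse_bumps (insert v V) R"
    then have "\<forall>w'\<in>R. w' \<le> w" using assms by (force simp: reverse_bumps_def)
    moreover have "w \<in> R" using w by (simp add: reverse_bumps_def)
    ultimately show "R \<noteq> {} \<and> w = Max R" using fR by (auto intro!: Max_eqI[symmetric])
  next
    assume w: "R \<noteq> {} \<and> w = Max R"
    then have "w \<in> R" "\<forall>w'\<in>R. w' \<le> w" using fR by auto
    then show "(w, v) \<in> reverse_bumps (insert v V) R"
      using assms by (auto simp: reverse_bumps_def not_less)
  qed
  moreover have "(w, u) \<in> reverse_bumps (insert v V) R \<longleftrightarrow> (w, u) \<in> reverse_bumps V R" if "u \<noteq> v" for w u
    using that by (auto simp: reverse_bumps_def)
  moreover have "(w, v) \<notin> reverse_bumps V R" for w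
    using assms by (auto simp: reverse_bumps_def)
  ultimately show ?thesis by auto (metis)+
qed

text \<open>
Push the removal inwards past the additions. It commutes with an addition to the first row. Passing an
addition of \<open>u\<close> below the first row leaves one extra term, in which \<open>u\<close> is added to the first row and a
removal from the first row remains; by \<open>down_first_tableaux\<close> that removal deletes the largest
\<open>v \<in> R\<close> below \<open>u\<close>. These terms are the reverse bumps.
\<close>

lemma down_below_tableaux:
  assumes "sorted_wrt (>) vs" "R \<subseteq> set vs" "length vs \<le> r" "1 \<le> r"
  shows "down_below r 0 (tableaux vs R) x =
    (\<Sum>(v, u)\<in>reverse_bumps (set vs) R. tableaux (removeAll v vs) (insert u (R - {v})) x)"
  using assms(1,2,3)
proof (induction vs arbitrary: R x)
  case Nil
  then show ?case by (simp add: down_below_def tableaux_Nil_down reverse_bumps_def del: tableaux.simps)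
next
  case (Cons m vs)
  have d: "distinct vs" "m \<notin> set vs" and lt: "\<forall>w\<in>set vs. w < m"
    using distinct_of_decreasing[OF Cons.prems(1)] Cons.prems(1) by auto
  show ?case
  proof (cases "m \<in> R")
    case True
    let ?B = "reverse_bumps (set vs) (R - {m})"
    have B: "reverse_bumps (set (m # vs)) R = ?B"
      using reverse_bumps_insert_in[OF True lt] Cons.prems by simp
    have "tableaux vs R = tableaux vs (R - {m})" using d by (intro tableaux_cong) auto
    then have IH: "down_below r 0 (tableaux vs R) y =
        (\<Sum>p\<in>?B. (case p of (v, u) \<Rightarrow> tableaux (removeAll v vs) (insert u (R - {m} - {v}))) y)" for y
      using Cons.IH[of "R - {m}" y] Cons.prems by (auto simp: case_prod_unfold)
    have "down_below r 0 (tableaux (m # vs) R) x = up r 0 0 (down_below r 0 (tableaux vs R)) x"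
      using True unfolding down_below_def[abs_def] by (simp add: up_sum down_up_commute)
    also have "\<dots> = (\<Sum>p\<in>?B. up r 0 0 (case p of (v, u) \<Rightarrow> tableaux (removeAll v vs) (insert u (R - {m} - {v}))) x)"
      unfolding IH up_sum ..
    also have "\<dots> = (\<Sum>(v, u)\<in>?B. tableaux (removeAll v (m # vs)) (insert u (R - {v})) x)"
    proof (rule sum.cong[OF refl], clarify)
      fix v u assume "(v, u) \<in> ?B"
      then have vu: "v \<noteq> m" "u \<noteq> m" using d by (auto simp: reverse_bumps_def)
      have "tableaux (removeAll v vs) (insert u (R - {m} - {v})) = tableaux (removeAll v vs) (insert u (R - {v}))"
        using d by (intro tableaux_cong) auto
      then show "up r 0 0 (tableaux (removeAll v vs) (insert u (R - {m} - {v}))) x =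
          tableaux (removeAll v (m # vs)) (insert u (R - {v})) x"
        using vu True by auto
    qed
    finally show ?thesis unfolding B .
  next
    case False
    then have R: "R \<subseteq> set vs" using Cons.prems by auto
    let ?B = "reverse_bumps (set vs) R"
    have IH: "down_below r 0 (tableaux vs R) y =
        (\<Sum>p\<in>?B. (case p of (v, u) \<Rightarrow> tableaux (removeAll v vs) (insert u (R - {v}))) y)" for y
      using Cons.IH[of R y] Cons.prems R by (auto simp: case_prod_unfold)
    have "down_below r 0 (tableaux (m # vs) R) x =
        up_below r 0 (down_below r 0 (tableaux vs R)) x + down r 0 1 (up r 0 1 (tableaux vs R)) x
        - up r 0 r (down r 0 r (tableaux vs R)) x"
      using False assms(4) by (simp add: down_below_up_below)
    also have "up r 0 r (down r 0 r (tableaux vs R)) x = 0"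
      using d Cons.prems by (intro up_down_last_tableaux) auto
    also have "down r 0 1 (up r 0 1 (tableaux vs R)) x = up r 0 0 (down r 0 0 (tableaux vs R)) x"
      using down_up_next[of 0 0 r] assms(4) by simp
    also have "\<dots> = (\<Sum>(v, u)\<in>(if R = {} then {} else {(Max R, m)}). tableaux (removeAll v (m # vs)) (insert u (R - {v})) x)"
    proof (cases "R = {}")
      case True
      then show ?thesis using down_first_tableaux[of vs R] Cons.prems R by (simp add: up_def)
    next
      case ne: False
      have "Max R \<in> R" using ne R finite_subset by (intro Max_in) auto
      then have ne': "Max R \<noteq> m" using False by auto
      have "tableaux (removeAll (Max R) vs) (R - {Max R}) = tableaux (removeAll (Max R) vs) (insert m (R - {Max R}))"
        using d by (intro tableaux_cong) auto
      then show ?thesis using down_first_tableaux[of vs R] Cons.prems R ne ne' by auto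
    qed
    also have "up_below r 0 (down_below r 0 (tableaux vs R)) x =
        (\<Sum>p\<in>?B. up_below r 0 (case p of (v, u) \<Rightarrow> tableaux (removeAll v vs) (insert u (R - {v}))) x)"
      unfolding IH up_below_sum ..
    also have "\<dots> = (\<Sum>(v, u)\<in>?B. tableaux (removeAll v (m # vs)) (insert u (R - {v})) x)"
    proof (rule sum.cong[OF refl], clarify)
      fix v u assume "(v, u) \<in> ?B"
      then have vu: "v \<noteq> m" "u \<noteq> m" using d R by (auto simp: reverse_bumps_def)
      then show "up_below r 0 (tableaux (removeAll v vs) (insert u (R - {v}))) x =
          tableaux (removeAll v (m # vs)) (insert u (R - {v})) x"
        using False by auto
    qed
    also have "(\<Sum>(v, u)\<in>?B. tableaux (removeAll v (m # vs)) (insert u (R - {v})) x) +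
        (\<Sum>(v, u)\<in>(if R = {} then {} else {(Max R, m)}). tableaux (removeAll v (m # vs)) (insert u (R - {v})) x) =
        (\<Sum>(v, u)\<in>reverse_bumps (set (m # vs)) R. tableaux (removeAll v (m # vs)) (insert u (R - {v})) x)"
      unfolding list.set reverse_bumps_insert_notin[OF False lt R finite_set]
      using d R finite_reverse_bumps[OF finite_set R]
      by (intro sum.union_disjoint[symmetric]) (auto simp: reverse_bumps_def)
    finally show ?thesis by simp
  qed
qed

end

context
  fixes r :: nat
begin

section \<open>Permutations as sums of squares\<close>

lemma walks_0_nonzero_chamber:
  assumes "x \<in> chamber r 0" "walks r 0 x \<noteq> 0"
  shows "x = vacuum r"
proof
  fix i
  show "x i = vacuum r i"
  proof (cases "i \<le> r")
    case True
    have "x i + int i \<le> x 0" "x r + int (r - i) \<le> x i"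
      using chamber_gap[OF assms(1), of 0 i] chamber_gap[OF assms(1), of i r] True by auto
    moreover have "x 0 \<le> int r" "0 \<le> x r" using assms by (auto split: if_splits simp: chamber_def)
    ultimately show ?thesis using True by (simp add: vacuum_def)
  qed (use assms in \<open>auto simp: chamber_def vacuum_def\<close>)
qed

lemma walks_0_vacuum: "walks r 0 (vacuum r) = 1"
proof -
  have "rank_perm r (vacuum r) = id" by (auto simp: rank_perm_def vacuum_def fun_eq_iff)
  then show ?thesis by (auto simp: vacuum_def permutes_id sign_id)
qed

text \<open>
Forgetting which letters are in the first row leaves all standard tableaux of the given shape.
\<close>

lemma sum_tableaux:
  assumes "distinct vs" "x \<in> chamber r 0" "1 \<le> r"
  shows "(\<Sum>R\<in>Pow (set vs). tableaux r vs R x) = walks r (length vs) x"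
  using assms(1,2)
proof (induction vs arbitrary: x)
  case Nil
  show ?case
  proof (cases "x = vacuum r")
    case True
    then show ?thesis using walks_0_vacuum by (simp del: walks.simps)
  next
    case False
    then have "walks r 0 x = 0" using walks_0_nonzero_chamber[of x] Nil by blast
    then show ?thesis using False by (simp del: walks.simps)
  qed
next
  case (Cons v vs)
  have v: "v \<notin> set vs" using Cons.prems by simp
  define W where "W = (\<lambda>x. \<Sum>R\<in>Pow (set vs). tableaux r vs R x)"
  have W: "W y = walks r (length vs) y" if "y \<in> chamber r 0" for y
    unfolding W_def using Cons that by simp
  have upW: "up r 0 j W y = up r 0 j (walks r (length vs)) y" for j y
    unfolding up_def using W by simp
  have inj: "inj_on (insert v) (Pow (set vs))" using v by (auto simp: inj_on_def)
  have "(\<Sum>R\<in>Pow (set (v # vs)). tableaux r (v # vs) R x) =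
      (\<Sum>R\<in>Pow (set vs). tableaux r (v # vs) R x) + (\<Sum>R\<in>insert v ` Pow (set vs). tableaux r (v # vs) R x)"
    unfolding list.set Pow_insert using v by (intro sum.union_disjoint) auto
  also have "(\<Sum>R\<in>Pow (set vs). tableaux r (v # vs) R x) = (\<Sum>R\<in>Pow (set vs). up_below r 0 (tableaux r vs R) x)"
    using v by (intro sum.cong) auto
  also have "\<dots> = up_below r 0 W x" unfolding W_def up_below_sum ..
  also have "(\<Sum>R\<in>insert v ` Pow (set vs). tableaux r (v # vs) R x) =
      (\<Sum>R\<in>Pow (set vs). up r 0 0 (tableaux r vs (insert v R)) x)"
    by (subst sum.reindex[OF inj]) simp
  also have "\<dots> = (\<Sum>R\<in>Pow (set vs). up r 0 0 (tableaux r vs R) x)"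
  proof (rule sum.cong[OF refl])
    fix R
    have "tableaux r vs (insert v R) = tableaux r vs R" using v by (intro tableaux_cong) auto
    then show "up r 0 0 (tableaux r vs (insert v R)) x = up r 0 0 (tableaux r vs R) x" by simp
  qed
  also have "\<dots> = up r 0 0 W x" unfolding W_def up_sum ..
  finally show ?case
    using walks_Suc_chamber[of 0 r x "length vs"] Cons.prems assms(3)
    by (simp add: upW up_below_def del: walks.simps)
qed

text \<open>
Both sides obey the recursion of \<open>card_row_lists_rec\<close>: on the right, the last step of the walk is moved
by adjointness to a removal of a box from \<open>tableaux\<close>, which was computed above. In terms of the
Robinson--Schensted correspondence, the sum runs over the pairs of an insertion tableau with first row
\<open>R\<close> and an arbitrary recording tableau of the same shape.
\<close>

lemma card_row_lists:
  assumes "sorted_wrt (>) vs" "R \<subseteq> set vs" "length vs = n" "n \<le> r" "1 \<le> r"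
  shows "int (card (row_lists (set vs) R)) =
    (\<Sum>x\<in>level r 0 (int n) (int (card R)). tableaux r vs R x * walks r n x)"
  using assms(1-4)
proof (induction n arbitrary: vs R)
  case 0
  then have vs: "vs = []" "R = {}" by auto
  have "row_lists {} {} = {[]}" by (auto simp: row_lists_def)
  moreover have "(\<Sum>x\<in>level r 0 0 0. tableaux r [] {} x * walks r 0 x) =
      (\<Sum>x\<in>{vacuum r}. tableaux r [] {} x * walks r 0 x)"
    using vacuum_level finite_level by (intro sum.mono_neutral_right) auto
  ultimately show ?case using vs walks_0_vacuum by (simp del: walks.simps)
next
  case (Suc n)
  let ?V = "set vs" and ?k = "int (card R)" and ?f = "walks r n"
  have d: "distinct vs" using distinct_of_decreasing Suc.prems by blast
  have ne: "?V \<noteq> {}" using Suc.prems by auto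
  have fR: "finite R" using Suc.prems finite_subset by blast
  have IH: "int (card (row_lists (?V - {v}) R')) =
      (\<Sum>x\<in>level r 0 (int n) (int (card R')). tableaux r (removeAll v vs) R' x * ?f x)"
    if "v \<in> ?V" "R' \<subseteq> ?V - {v}" for v R'
  proof -
    have "sorted_wrt (>) (removeAll v vs)"
      using Suc.prems(1) by (simp add: removeAll_filter_not_eq sorted_wrt_filter)
    moreover have "length (removeAll v vs) = n"
      using d that Suc.prems(3) by (simp add: distinct_remove1_removeAll[symmetric] length_remove1)
    ultimately show ?thesis using Suc.IH[of "removeAll v vs" R'] that Suc.prems(4) by simp
  qed
  have "(\<Sum>x\<in>level r 0 (int (Suc n)) ?k. tableaux r vs R x * walks r (Suc n) x) =
      (\<Sum>x\<in>level r 0 (int n + 1) ?k. up r 0 0 ?f x * tableaux r vs R x + up_below r 0 ?f x * tableaux r vs R x)"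
    using walks_Suc_chamber[of 0 r _ n] assms(5)
    by (intro sum.cong) (auto simp: level_def algebra_simps simp del: walks.simps)
  also have "\<dots> = (\<Sum>x\<in>level r 0 (int n) (?k - 1). ?f x * down r 0 0 (tableaux r vs R) x) +
      (\<Sum>x\<in>level r 0 (int n) ?k. ?f x * down_below r 0 (tableaux r vs R) x)"
    by (simp add: sum.distrib adjoint_first adjoint_below)
  also have "(\<Sum>x\<in>level r 0 (int n) (?k - 1). ?f x * down r 0 0 (tableaux r vs R) x) =
      int (if R = {} then 0 else card (row_lists (?V - {Max R}) (R - {Max R})))"
  proof (cases "R = {}")
    case False
    then have m: "Max R \<in> R" using fR by simp
    have "int (card (R - {Max R})) = ?k - 1" using m fR card_gt_0_iff[of R] by (auto simp: of_nat_diff)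
    moreover have "Max R \<in> ?V" "R - {Max R} \<subseteq> ?V - {Max R}" using m Suc.prems(2) by auto
    note IH[OF this]
    ultimately show ?thesis using False down_first_tableaux[OF Suc.prems(1,2), of r]
      by (simp add: mult.commute del: walks.simps)
  qed (use down_first_tableaux[of vs R r] Suc.prems in simp)
  also have "(\<Sum>x\<in>level r 0 (int n) ?k. ?f x * down_below r 0 (tableaux r vs R) x) =
      (\<Sum>p\<in>reverse_bumps ?V R. \<Sum>x\<in>level r 0 (int n) ?k.
        (case p of (v, u) \<Rightarrow> tableaux r (removeAll v vs) (insert u (R - {v})) x * ?f x))"
  proof -
    have "down_below r 0 (tableaux r vs R) x =
        (\<Sum>p\<in>reverse_bumps ?V R. (case p of (v, u) \<Rightarrow> tableaux r (removeAll v vs) (insert u (R - {v})) x))" for x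
      using down_below_tableaux[of vs R r] Suc.prems assms(5) by (simp add: case_prod_unfold)
    then have "(\<Sum>x\<in>level r 0 (int n) ?k. ?f x * down_below r 0 (tableaux r vs R) x) =
        (\<Sum>x\<in>level r 0 (int n) ?k. \<Sum>p\<in>reverse_bumps ?V R.
          (case p of (v, u) \<Rightarrow> tableaux r (removeAll v vs) (insert u (R - {v})) x * ?f x))"
      by (simp only: sum_distrib_left case_prod_unfold mult.commute[of "walks r n _"])
    also have "\<dots> = (\<Sum>p\<in>reverse_bumps ?V R. \<Sum>x\<in>level r 0 (int n) ?k.
        (case p of (v, u) \<Rightarrow> tableaux r (removeAll v vs) (insert u (R - {v})) x * ?f x))"
      by (rule sum.swap)
    finally show ?thesis .
  qed
  also have "\<dots> = (\<Sum>(v, u)\<in>reverse_bumps ?V R. int (card (row_lists (?V - {v}) (insert u (R - {v})))))"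
  proof (rule sum.cong[OF refl], clarify)
    fix v u assume vu: "(v, u) \<in> reverse_bumps ?V R"
    then have *: "v \<in> R" "u \<notin> R" "v \<in> ?V" "insert u (R - {v}) \<subseteq> ?V - {v}"
      using Suc.prems by (auto simp: reverse_bumps_def)
    have "card (insert u (R - {v})) = card R"
      using * fR card_gt_0_iff[of R] by (auto simp: card_insert_if)
    then show "(\<Sum>x\<in>level r 0 (int n) ?k. tableaux r (removeAll v vs) (insert u (R - {v})) x * ?f x) =
        int (card (row_lists (?V - {v}) (insert u (R - {v}))))"
      using IH[OF *(3,4)] by simp
  qed
  finally show ?case using card_row_lists_rec[OF finite_set ne Suc.prems(2)]
    by (simp add: case_prod_unfold del: walks.simps)
qed

lemma card_LIS_eq_sum_walks:
  assumes "n \<le> r" "1 \<le> r"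
  shows "int (card {\<sigma>. \<sigma> permutes {1..n} \<and> LIS n \<sigma> = k}) = (\<Sum>x\<in>level r 0 (int n) (int k). (walks r n x)\<^sup>2)"
proof -
  define vs where "vs = rev [1..<n + 1]"
  have vs: "sorted_wrt (>) vs" "set vs = {1..n}" "length vs = n" "distinct vs"
    by (auto simp: vs_def sorted_wrt_rev simp del: upt_Suc)
  let ?S = "{R. R \<subseteq> {1..n} \<and> card R = k}"
  have "int (card {\<sigma>. \<sigma> permutes {1..n} \<and> LIS n \<sigma> = k}) = (\<Sum>R\<in>?S. int (card (row_lists (set vs) R)))"
    unfolding card_LIS_eq_sum_row_lists vs(2) by simp
  also have "\<dots> = (\<Sum>R\<in>?S. \<Sum>x\<in>level r 0 (int n) (int k). tableaux r vs R x * walks r n x)"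
    using card_row_lists[OF vs(1) _ vs(3) assms] vs(2) by (intro sum.cong) auto
  also have "\<dots> = (\<Sum>x\<in>level r 0 (int n) (int k). \<Sum>R\<in>?S. tableaux r vs R x * walks r n x)"
    by (rule sum.swap)
  also have "\<dots> = (\<Sum>x\<in>level r 0 (int n) (int k). (walks r n x)\<^sup>2)"
  proof (rule sum.cong[OF refl])
    fix x assume x: "x \<in> level r 0 (int n) (int k)"
    have "(\<Sum>R\<in>?S. tableaux r vs R x) = (\<Sum>R\<in>Pow (set vs). tableaux r vs R x)"
    proof (rule sum.mono_neutral_left)
      show "\<forall>R\<in>Pow (set vs) - ?S. tableaux r vs R x = 0"
      proof (rule ballI, rule ccontr)
        fix R assume R: "R \<in> Pow (set vs) - ?S" "tableaux r vs R x \<noteq> 0"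
        from tableaux_level[OF vs(4) R(2)] have "int (card (R \<inter> set vs)) = int k"
          using x by (simp add: level_def)
        moreover have "R \<inter> set vs = R" using R by auto
        ultimately show False using R vs(2) by auto
      qed
    qed (auto simp: vs(2))
    also have "\<dots> = walks r n x" using sum_tableaux[OF vs(4) _ assms(2)] x vs(3) by (simp add: level_def)
    finally show "(\<Sum>R\<in>?S. tableaux r vs R x * walks r n x) = (walks r n x)\<^sup>2"
      by (simp add: sum_distrib_right[symmetric] power2_eq_square)
  qed
  finally show ?thesis .
qed

end

context
  fixes r :: nat
  assumes r_pos: "1 \<le> r"
begin

section \<open>Freeing the first row\<close>

definition pairing :: "int \<Rightarrow> int \<Rightarrow> ((nat \<Rightarrow> int) \<Rightarrow> int) \<Rightarrow> ((nat \<Rightarrow> int) \<Rightarrow> int) \<Rightarrow> int" where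
  "pairing N k c d = (\<Sum>x\<in>level r 1 N k. c x * d x)"

lemma pairing_cong:
  "(\<And>x. x \<in> level r 1 N k \<Longrightarrow> c x = c' x) \<Longrightarrow> (\<And>x. x \<in> level r 1 N k \<Longrightarrow> d x = d' x) \<Longrightarrow>
    pairing N k c d = pairing N k c' d'"
  unfolding pairing_def by (intro sum.cong) auto

lemma pairing_commute: "pairing N k c d = pairing N k d c"
  unfolding pairing_def by (simp add: mult.commute)

lemma pairing_add_left: "pairing N k (\<lambda>x. c x + c' x) d = pairing N k c d + pairing N k c' d"
  unfolding pairing_def by (simp add: algebra_simps sum.distrib)

lemma pairing_add_right: "pairing N k d (\<lambda>x. c x + c' x) = pairing N k d c + pairing N k d c'"
  unfolding pairing_def by (simp add: algebra_simps sum.distrib)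

lemma pairing_diff_left: "pairing N k (\<lambda>x. c x - c' x) d = pairing N k c d - pairing N k c' d"
  unfolding pairing_def by (simp add: algebra_simps sum_subtractf)

lemma pairing_diff_right: "pairing N k d (\<lambda>x. c x - c' x) = pairing N k d c - pairing N k d c'"
  unfolding pairing_def by (simp add: algebra_simps sum_subtractf)

lemma pairing_scale_left: "pairing N k (\<lambda>x. a * c x) d = a * pairing N k c d"
  unfolding pairing_def by (simp add: sum_distrib_left mult.assoc)

lemma pairing_scale_right: "pairing N k d (\<lambda>x. a * c x) = a * pairing N k d c"
  unfolding pairing_def by (simp add: sum_distrib_left mult_ac)

lemma pairing_up_below: "pairing (N + 1) k (up_below r 1 c) d = pairing N k c (down_below r 1 d)"
  unfolding pairing_def by (rule adjoint_below) simp

lemma pairing_up_first: "pairing (N + 1) k (up r 1 0 c) d = pairing N (k - 1) c (down r 1 0 d)"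
  unfolding pairing_def by (rule adjoint_first) simp

lemma first_invertible:
  assumes "x \<in> chamber r 1"
  shows "down r 1 0 (up r 1 0 c) x = c x" "up r 1 0 (down r 1 0 c) x = c x"
  using assms first_free_chamber[OF r_pos] by (auto simp: up_def down_def)

lemma down_below_up_first: "down_below r 1 (up r 1 0 c) x = up r 1 0 (down_below r 1 c) x"
proof -
  have "down r 1 j (up r 1 0 c) x = up r 1 0 (down r 1 j c) x" if "j \<in> {1..r}" for j
  proof -
    have 1: "inc j x \<in> chamber r 1 \<longleftrightarrow> inc j (dec 0 x) \<in> chamber r 1"
      using first_free_chamber[OF r_pos, of "inc j x" "x 0 - 1"] that by (simp add: fun_upd_twist)
    have "dec 0 (inc j x) = inc j (dec 0 x)" using that by (auto simp: fun_upd_twist)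
    then show ?thesis unfolding up_def down_def using 1 first_free_chamber[OF r_pos] by simp
  qed
  then show ?thesis unfolding down_below_def[abs_def] up_sum by simp
qed

lemma level_1_sum:
  assumes "x \<in> level r 1 N k"
  shows "k + int r + (\<Sum>i=1..r. x i) = N + (\<Sum>i=1..r. int i)"
proof -
  have "{..r} = insert 0 {1..r}" by auto
  then show ?thesis using assms by (simp add: level_def)
qed

lemma sum_reflect: "(\<Sum>i=1..r. int (r - i) + 1) = (\<Sum>i=1..r. int i)"
  by (rule sum.reindex_bij_witness[of _ "\<lambda>i. r + 1 - i" "\<lambda>i. r + 1 - i"]) auto

lemma up_down_last_level:
  assumes "x \<in> level r 1 N k" "N - k < int r"
  shows "up r 1 r (down r 1 r c) x = 0"
proof (rule ccontr)
  assume "\<not> ?thesis"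
  then have x: "x \<in> chamber r 1" "dec r x \<in> chamber r 1"
    by (auto simp: up_down_diagonal split: if_splits)
  then have "1 \<le> x r" using dec_chamber_iff[OF x(1), of r] r_pos by simp
  then have "(\<Sum>i=1..r. int (r - i) + 1) \<le> (\<Sum>i=1..r. x i)"
    using chamber_gap[OF x(1), of _ r] by (intro sum_mono) fastforce
  then show False using level_1_sum[OF assms(1)] assms(2) unfolding sum_reflect by linarith
qed

definition norm_walks :: "nat \<Rightarrow> int \<Rightarrow> int" where
  "norm_walks n k = pairing (int n) k (walks r n) (walks r n)"

text \<open>
Write \<open>S\<close> and \<open>T\<close> for adding and removing a box in the first row, which are mutually inverse here, and
\<open>U\<close> and \<open>D\<close> for the rows below. On the vectors \<open>f = walks n\<close> and \<open>g = walks (n - 1)\<close> the two facts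
\<open>walks (n + 1) = S f + U f\<close> and \<open>n g = T f + D f\<close>, the adjointness of \<open>S\<close>, \<open>T\<close> and of \<open>U\<close>, \<open>D\<close>, and
\<open>D U = U D + 1\<close> reduce every inner product to norms and to the mixed products
\<open>X k = \<langle>g, T f\<rangle>\<close>. Those cancel by a second evaluation of the norm of \<open>f\<close>.
\<close>

lemma norm_walks_rec:
  assumes "n \<le> r" "int n - k < int r"
  shows "norm_walks (n + 1) k + (int n)\<^sup>2 * norm_walks (n - 1) k =
    norm_walks n (k + 1) + (2 * int n - 1) * norm_walks n k + norm_walks n (k - 1)"
proof -
  define N where "N = int n"
  define f where "f = walks r n"
  define g where "g = walks r (n - 1)"
  define Sf where "Sf = up r 1 0 f"
  define Tf where "Tf = down r 1 0 f"
  define Uf where "Uf = up_below r 1 f"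
  define Df where "Df = down_below r 1 f"
  define X where "X k = pairing (N - 1) (k - 1) g Tf" for k
  have Df: "Df x = N * g x - Tf x" if "x \<in> level r 1 (N - 1) k'" "k' \<ge> k - 1" for x k'
    using down_walks[OF r_pos, of x n] that assms
    by (simp add: level_def Df_def Tf_def f_def g_def N_def)
  \<comment> \<open>Shifting the first row preserves norms.\<close>
  have TT: "pairing (N - 1) k' Tf Tf = norm_walks n (k' + 1)" for k'
  proof -
    have "pairing (N - 1) k' Tf Tf = pairing N (k' + 1) (up r 1 0 Tf) f"
      using pairing_up_first[of "N - 1" "k' + 1" Tf f] by (simp add: Tf_def)
    also have "\<dots> = pairing N (k' + 1) f f"
      unfolding Tf_def
      by (intro pairing_cong) (simp_all add: first_invertible level_def del: One_nat_def)
    finally show ?thesis by (simp add: norm_walks_def f_def N_def)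
  qed
  have ng: "N\<^sup>2 * pairing (N - 1) k g g = N\<^sup>2 * norm_walks (n - 1) k"
    by (cases n) (auto simp: N_def norm_walks_def g_def)
  have SS: "pairing (N + 1) k Sf Sf = norm_walks n (k - 1)"
  proof -
    have "pairing (N + 1) k Sf Sf = pairing N (k - 1) f (down r 1 0 Sf)"
      using pairing_up_first[of N k f Sf] by (simp add: Sf_def)
    also have "\<dots> = pairing N (k - 1) f f"
      unfolding Sf_def
      by (intro pairing_cong) (simp_all add: first_invertible level_def del: One_nat_def)
    finally show ?thesis by (simp add: norm_walks_def f_def N_def)
  qed
  have SU: "pairing (N + 1) k Sf Uf = N * X k - norm_walks n k"
  proof -
    have "pairing (N + 1) k Sf Uf = pairing N k f (down_below r 1 Sf)"
      using pairing_up_below[of N k f Sf] by (simp add: Uf_def pairing_commute)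
    also have "\<dots> = pairing N k (up r 1 0 Df) f"
      unfolding Sf_def Df_def down_below_up_first[abs_def] by (simp add: pairing_commute)
    also have "\<dots> = pairing (N - 1) (k - 1) Df Tf"
      using pairing_up_first[of "N - 1" k Df f] by (simp add: Tf_def)
    also have "\<dots> = pairing (N - 1) (k - 1) (\<lambda>x. N * g x - Tf x) Tf"
      by (intro pairing_cong Df) auto
    also have "\<dots> = N * X k - norm_walks n k"
      by (simp add: pairing_diff_left pairing_scale_left TT X_def)
    finally show ?thesis .
  qed
  have DD: "pairing (N - 1) k Df Df = N\<^sup>2 * norm_walks (n - 1) k - 2 * N * X (k + 1) + norm_walks n (k + 1)"
  proof -
    have "pairing (N - 1) k Df Df = pairing (N - 1) k (\<lambda>x. N * g x - Tf x) (\<lambda>x. N * g x - Tf x)"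
      by (intro pairing_cong Df) auto
    also have "\<dots> = N * (N * pairing (N - 1) k g g) - N * pairing (N - 1) k g Tf
        - (N * pairing (N - 1) k Tf g - pairing (N - 1) k Tf Tf)"
      by (simp add: pairing_diff_left pairing_diff_right pairing_scale_left pairing_scale_right algebra_simps)
    also have "\<dots> = N\<^sup>2 * pairing (N - 1) k g g - 2 * N * X (k + 1) + norm_walks n (k + 1)"
      by (simp add: pairing_commute[of _ _ Tf g] TT X_def power2_eq_square)
    finally show ?thesis unfolding ng .
  qed
  have UU: "pairing (N + 1) k Uf Uf = norm_walks n k + pairing (N - 1) k Df Df"
  proof -
    have "pairing (N + 1) k Uf Uf = pairing N k f (down_below r 1 Uf)"
      using pairing_up_below[of N k f Uf] by (simp add: Uf_def)
    also have "\<dots> = pairing N k f (\<lambda>x. up_below r 1 Df x + f x)"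
    proof (rule pairing_cong[OF refl])
      fix x assume x: "x \<in> level r 1 N k"
      have "down r 1 1 (up r 1 1 f) x = f x"
        using down_up_first[OF r_pos, of f x] x by (simp add: level_def)
      moreover have "up r 1 r (down r 1 r f) x = 0"
        using up_down_last_level[OF x] assms(2) by (simp add: N_def)
      ultimately show "down_below r 1 Uf x = up_below r 1 Df x + f x"
        unfolding Uf_def Df_def using down_below_up_below[of 1 r f x] r_pos by simp
    qed
    also have "\<dots> = pairing N k (up_below r 1 Df) f + norm_walks n k"
      unfolding pairing_add_right pairing_commute[of N k f "up_below r 1 Df"]
      by (simp add: norm_walks_def f_def N_def)
    also have "pairing N k (up_below r 1 Df) f = pairing (N - 1) k Df Df"
      using pairing_up_below[of "N - 1" k Df f] by (simp add: Df_def)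
    finally show ?thesis by simp
  qed
  have next_norm: "norm_walks (n + 1) k = pairing (N + 1) k Sf Sf + 2 * pairing (N + 1) k Sf Uf + pairing (N + 1) k Uf Uf"
  proof -
    have step: "walks r (n + 1) x = Sf x + Uf x" if "x \<in> level r 1 (N + 1) k" for x
      using walks_Suc_chamber[OF order.refl r_pos, of x n] that
      unfolding Sf_def Uf_def f_def level_def by (simp only: mem_Collect_eq Suc_eq_plus1)
    have "norm_walks (n + 1) k = pairing (N + 1) k (walks r (n + 1)) (walks r (n + 1))"
      by (simp only: norm_walks_def N_def of_nat_add of_nat_1)
    also have "\<dots> = pairing (N + 1) k (\<lambda>x. Sf x + Uf x) (\<lambda>x. Sf x + Uf x)"
      by (intro pairing_cong step)
    finally have "norm_walks (n + 1) k = pairing (N + 1) k (\<lambda>x. Sf x + Uf x) (\<lambda>x. Sf x + Uf x)" .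
    then show ?thesis
      by (simp add: pairing_add_left pairing_add_right pairing_commute[of _ _ Uf Sf])
  qed
  \<comment> \<open>The norm of \<open>f\<close> once more, now taking the step to \<open>n\<close> apart
    in one argument only.\<close>
  have "N * norm_walks n k = N * X k + N * (N * norm_walks (n - 1) k) - N * X (k + 1)"
  proof (cases n)
    case 0
    then show ?thesis by (simp add: N_def)
  next
    case (Suc m)
    have "norm_walks n k = pairing N k (\<lambda>x. up r 1 0 g x + up_below r 1 g x) f"
      unfolding norm_walks_def N_def f_def[symmetric]
    proof (rule pairing_cong[OF _ refl])
      fix x assume "x \<in> level r 1 (int n) k"
      then show "f x = up r 1 0 g x + up_below r 1 g x"
        using walks_Suc_chamber[OF order.refl r_pos, of x m]
        unfolding level_def f_def g_def Suc by (simp only: mem_Collect_eq diff_Suc_1)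
    qed
    also have "\<dots> = pairing (N - 1) (k - 1) g Tf + pairing (N - 1) k g Df"
      using pairing_up_first[of "N - 1" k g f] pairing_up_below[of "N - 1" k g f]
      by (simp add: pairing_add_left Tf_def Df_def)
    also have "pairing (N - 1) k g Df = pairing (N - 1) k g (\<lambda>x. N * g x - Tf x)"
      by (intro pairing_cong Df) auto
    also have "\<dots> = N * pairing (N - 1) k g g - X (k + 1)"
      by (simp add: pairing_diff_right pairing_scale_right X_def)
    also have "pairing (N - 1) k g g = norm_walks (n - 1) k"
      using Suc by (simp add: norm_walks_def g_def N_def)
    finally have "norm_walks n k = X k + (N * norm_walks (n - 1) k - X (k + 1))" by (simp add: X_def)
    from arg_cong[OF this, of "\<lambda>z. N * z"] show ?thesis by (simp add: algebra_simps)
  qed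
  then show ?thesis unfolding next_norm SS SU UU DD N_def[symmetric]
    by (simp add: power2_eq_square algebra_simps)
qed

text \<open>
A point of \<open>chamber 1\<close> that is not a partition has \<open>x 0 \<le> x 1\<close>. If the inequality is strict then the
second row has at least \<open>k + 2\<close> boxes, too many for \<open>n \<le> 2 k + 1\<close>; and if \<open>x 0 = x 1\<close> then
\<open>walks\<close> vanishes.
\<close>

lemma norm_walks_eq_chamber_0:
  assumes "int n \<le> 2 * k + 1"
  shows "norm_walks n k = (\<Sum>x\<in>level r 0 (int n) k. (walks r n x)\<^sup>2)"
  unfolding norm_walks_def pairing_def power2_eq_square
proof (rule sum.mono_neutral_right)
  show "level r 0 (int n) k \<subseteq> level r 1 (int n) k" by (auto simp: level_def chamber_def)
  show "\<forall>x\<in>level r 1 (int n) k - level r 0 (int n) k. walks r n x * walks r n x = 0"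
  proof
    fix x assume x: "x \<in> level r 1 (int n) k - level r 0 (int n) k"
    then have x1: "x \<in> chamber r 1" "x \<notin> chamber r 0" "x 0 = k + int r" by (auto simp: level_def)
    have "x 0 \<le> x 1"
    proof (rule ccontr)
      assume a: "\<not> x 0 \<le> x 1"
      have "x (Suc i) < x i" if "i < r" for i
        using x1(1) a that by (cases i) (auto simp: chamber_def)
      then show False using x1 by (auto simp: chamber_def)
    qed
    moreover have "\<not> x 0 < x 1"
    proof
      assume lt: "x 0 < x 1"
      have "int (r - i) \<le> x i" if "i \<in> {1..r}" for i
        using chamber_gap[OF x1(1), of i r] chamber_nonneg[OF x1(1), of r] that by auto
      moreover have "{1..r} = insert 1 {2..r}" using r_pos by auto
      ultimately have "x 1 + (\<Sum>i=2..r. int (r - i)) \<le> (\<Sum>i=1..r. x i)"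
        by (auto intro!: sum_mono)
      moreover have "(\<Sum>i=1..r. int (r - i) + 1) = int r + int (r - 1) + (\<Sum>i=2..r. int (r - i))"
        using \<open>{1..r} = insert 1 {2..r}\<close> r_pos by (simp add: sum.distrib of_nat_diff)
      ultimately show False
        using level_1_sum[of x "int n" k] x lt x1(3) assms r_pos unfolding sum_reflect by (simp add: of_nat_diff)
    qed
    ultimately have "walks r n x = 0" using r_pos by (intro walks_eq_0_if_coincident[of 0 r 1]) auto
    then show "walks r n x * walks r n x = 0" by simp
  qed
qed (simp add: finite_level)

text \<open>
For \<open>k = - q \<le> 0\<close> the only point that counts is the permutation of \<open>r, \<dots>, 0\<close> that moves \<open>r - q\<close> to
the front; as a pair it is the first row \<open>- q\<close> above a column of \<open>q\<close> boxes.
\<close>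

lemma norm_walks_0:
  assumes "- int r \<le> k"
  shows "norm_walks 0 k = (if k \<le> 0 then 1 else 0)"
proof (cases "k \<le> 0")
  case False
  have "walks r 0 x = 0" if "x \<in> level r 1 0 k" for x
    using that False by (auto simp: level_def)
  then show ?thesis using False by (simp add: norm_walks_def pairing_def del: walks.simps)
next
  case True
  define q where "q = nat (- k)"
  have q: "k = - int q" "q \<le> r" using True assms by (auto simp: q_def)
  \<comment> \<open>The permutation of \<open>r, \<dots>, 0\<close> that has \<open>r - q\<close> in
    front and is decreasing afterwards.\<close>
  define e where "e i = (if i = 0 then int (r - q) else if i \<le> q then int (r - i) + 1
    else if i \<le> r then int (r - i) else 0)" for i
  have rk: "rank_perm r e = (\<lambda>i. if i = 0 then q else if i \<le> q then i - 1 else i)"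
    using q by (auto simp: rank_perm_def e_def fun_eq_iff)
  have perm: "rank_perm r e permutes {..r}"
  proof (rule bij_imp_permutes)
    show "bij_betw (rank_perm r e) {..r} {..r}" unfolding rk
      by (rule bij_betw_byWitness[where f' = "\<lambda>i. if i < q then i + 1 else if i = q then 0 else i"])
        (use q in auto)
  qed (use q in \<open>auto simp: rk\<close>)
  have e0: "walks r 0 e = sign (rank_perm r e)"
    using perm q by (auto simp: e_def)
  then have e1: "walks r 0 e * walks r 0 e = 1" by (simp add: sign_def)
  have "(\<Sum>i\<le>r. e i) = int 0 + (\<Sum>i\<le>r. int i)" using walks_sum[of r 0 e] e1
    by (metis mult_zero_left zero_neq_one)
  moreover have "e \<in> chamber r 1" using q by (auto simp: chamber_def e_def)
  ultimately have e_level: "e \<in> level r 1 0 k" using q by (simp add: level_def e_def of_nat_diff)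
  \<comment> \<open>Below the first row each coordinate has only two possible values, and the value
    \<open>r - q\<close> is already taken by \<open>x 0\<close>; this decides between them.\<close>
  have uniq: "x = e" if x: "x \<in> level r 1 0 k" "walks r 0 x \<noteq> 0" for x
  proof
    fix i
    have xc: "x \<in> chamber r 1" "x 0 = int (r - q)" using x q by (auto simp: level_def)
    have ub: "x j \<le> int r" if "j \<le> r" for j using x(2) that by (auto split: if_splits)
    have ne: "x j \<noteq> x 0" if "1 \<le> j" "j \<le> r" for j
      using walks_eq_0_if_coincident[of j r 0 x 0] that x(2) by fastforce
    have lo: "int (r - j) \<le> x j" if "1 \<le> j" "j \<le> r" for j
      using chamber_gap[OF xc(1), of j r] chamber_nonneg[OF xc(1), of r] that r_pos by auto
    have hi: "x j \<le> int (r - j) + 1" if "1 \<le> j" "j \<le> r" for j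
      using chamber_gap[OF xc(1), of 1 j] ub[of 1] that r_pos by auto
    consider "i = 0" | "1 \<le> i" "i \<le> q" | "q < i" "i \<le> r" | "r < i" by linarith
    then show "x i = e i"
    proof cases
      case 1
      then show ?thesis using xc by (simp add: e_def)
    next
      case 2
      have "x i \<noteq> int (r - i)"
      proof
        assume "x i = int (r - i)"
        then have "x q = x 0"
          using chamber_gap[OF xc(1), of i q] lo[of q] 2 q xc(2) by auto
        then show False using ne[of q] 2 q by auto
      qed
      then show ?thesis using lo[of i] hi[of i] 2 q by (auto simp: e_def)
    next
      case 3
      have "x i \<noteq> int (r - i) + 1"
      proof
        assume "x i = int (r - i) + 1"
        then have "x (q + 1) = x 0"
          using chamber_gap[OF xc(1), of "q + 1" i] hi[of "q + 1"] 3 q xc(2) by auto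
        then show False using ne[of "q + 1"] 3 q by auto
      qed
      then show ?thesis using lo[of i] hi[of i] 3 q by (auto simp: e_def)
    next
      case 4
      then show ?thesis using xc(1) q by (auto simp: e_def chamber_def)
    qed
  qed
  have "norm_walks 0 k = (\<Sum>x\<in>{e}. walks r 0 x * walks r 0 x)"
    unfolding norm_walks_def pairing_def of_nat_0
  proof (rule sum.mono_neutral_right)
    show "finite (level r 1 0 k)" by (rule finite_level) simp
    show "{e} \<subseteq> level r 1 0 k" using e_level by simp
    show "\<forall>x\<in>level r 1 0 k - {e}. walks r 0 x * walks r 0 x = 0"
      using uniq by (metis DiffD1 DiffD2 mult_zero_left singletonI)
  qed
  then show ?thesis using True e1 by (simp del: walks.simps)
qed

end

section \<open>The closed form\<close>

text \<open>
The number of pairs of a permutation of \<open>n\<close> elements and an increasing subsequence of length \<open>t\<close> in it: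
choose the positions and the values of the subsequence, and arrange the rest.
\<close>

definition placements :: "nat \<Rightarrow> nat \<Rightarrow> int" where
  "placements n t = int ((n choose t)\<^sup>2 * fact (n - t))"

text \<open>
Iterated second central differences of the indicator function of \<open>k \<le> 0\<close>; for \<open>t \<ge> 1\<close> the value is
\<open>(-1) ^ (t - k) * ((2 * t - 1) choose (t - k))\<close> if \<open>k \<le> t\<close>, and 0 otherwise. The first recurrence says that the second difference in \<open>k\<close> is
an operator acting on \<open>n\<close>, which is why this basis solves it.
\<close>

primrec step_differences :: "nat \<Rightarrow> int \<Rightarrow> int" where
  "step_differences 0 k = (if k \<le> 0 then 1 else 0)"
| "step_differences (Suc t) k = step_differences t (k - 1) - 2 * step_differences t k + step_differences t (k + 1)"

definition closed_form :: "nat \<Rightarrow> int \<Rightarrow> int" where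
  "closed_form n k = (\<Sum>t\<le>n. step_differences t k * placements n t)"

lemma placements_fact: "real_of_int (placements (t + d) t) * ((fact t)\<^sup>2 * fact d) = (fact (t + d))\<^sup>2"
proof -
  have "real ((t + d) choose t) = fact (t + d) / (fact t * fact d)"
    by (simp add: binomial_fact)
  then show ?thesis by (simp add: placements_def power2_eq_square)
qed

lemma placements_beyond: "n < t \<Longrightarrow> placements n t = 0"
  by (simp add: placements_def binomial_eq_0)

lemma placements_absorb:
  assumes "t \<le> n + 1"
  shows "(int n + 1 - int t) * placements (n + 1) t = (int n + 1)\<^sup>2 * placements n t"
proof (cases "t = n + 1")
  case True
  then show ?thesis by (simp add: placements_beyond)
next
  case False
  then obtain d where n: "n = t + d" using assms by (metis Suc_eq_plus1 le_Suc_eq le_Suc_ex)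
  define c where "c = ((fact t)\<^sup>2 * fact (d + 1) :: real)"
  define f where "f = ((fact (t + d))\<^sup>2 :: real)"
  have c: "c \<noteq> 0" by (simp add: c_def)
  have f1: "(fact (t + (d + 1)) :: real) = (real t + d + 1) * fact (t + d)" by (simp add: algebra_simps)
  have next_n: "real_of_int (placements (n + 1) t) * c = (real t + d + 1)\<^sup>2 * f"
    unfolding n add.assoc c_def f_def placements_fact f1 power_mult_distrib ..
  have "real_of_int (placements n t) * c = (real d + 1) * (real_of_int (placements (t + d) t) * ((fact t)\<^sup>2 * fact d))"
    by (simp add: n c_def algebra_simps)
  then have this_n: "real_of_int (placements n t) * c = (real d + 1) * f"
    unfolding placements_fact f_def .
  have "real_of_int ((int n + 1 - int t) * placements (n + 1) t) * c =
      (real d + 1) * (real_of_int (placements (n + 1) t) * c)"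
    by (simp add: n algebra_simps)
  also have "\<dots> = (real n + 1)\<^sup>2 * (real_of_int (placements n t) * c)"
    unfolding next_n this_n by (simp add: n)
  also have "\<dots> = real_of_int ((int n + 1)\<^sup>2 * placements n t) * c"
    by simp
  finally have "real_of_int ((int n + 1 - int t) * placements (n + 1) t) = real_of_int ((int n + 1)\<^sup>2 * placements n t)"
    using c by (simp only: mult_cancel_right simp_thms)
  then show ?thesis by (simp only: of_int_eq_iff)
qed

lemma placements_rec:
  "placements (n + 1) t + (int n)\<^sup>2 * placements (n - 1) t =
    (if t = 0 then 0 else placements n (t - 1)) + (2 * int n + 1) * placements n t"
proof -
  consider "n + 1 < t" | "t = n + 1" | "t = n" | d where "n = t + Suc d"
    by (metis Suc_eq_plus1 add_Suc_right less_iff_Suc_add linorder_neqE_nat not_less_eq)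
  then show ?thesis
  proof cases
    case 1
    then show ?thesis by (simp add: placements_beyond)
  next
    case 2
    then show ?thesis by (simp add: placements_beyond) (simp add: placements_def)
  next
    case 3
    then show ?thesis
      by (cases n) (simp_all add: placements_beyond, simp_all add: placements_def power2_eq_square algebra_simps)
  next
    case (4 d)
    define c where "c = ((fact t)\<^sup>2 * fact (d + 2) :: real)"
    define f where "f = ((fact (t + d))\<^sup>2 :: real)"
    have c: "c \<noteq> 0" by (simp add: c_def)
    have f1: "(fact (t + (d + 1)) :: real) = (real t + d + 1) * fact (t + d)"
      by (simp add: algebra_simps)
    have f2: "(fact (t + (d + 2)) :: real) = (real t + d + 2) * ((real t + d + 1) * fact (t + d))"
      by (simp add: algebra_simps)
    have n: "n + 1 = t + (d + 2)" "n = t + (d + 1)" "n - 1 = t + d" using 4 by auto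
    have next_n: "real_of_int (placements (n + 1) t) * c = (real t + d + 2)\<^sup>2 * ((real t + d + 1)\<^sup>2 * f)"
      unfolding n(1) c_def f_def placements_fact f2 power_mult_distrib ..
    have "real_of_int (placements n t) * c =
        (real d + 2) * (real_of_int (placements (t + (d + 1)) t) * ((fact t)\<^sup>2 * fact (d + 1)))"
      by (simp add: n(2) c_def algebra_simps)
    then have this_n: "real_of_int (placements n t) * c = (real d + 2) * ((real t + d + 1)\<^sup>2 * f)"
      unfolding placements_fact f1 f_def power_mult_distrib .
    have "real_of_int (placements (n - 1) t) * c =
        (real d + 2) * (real d + 1) * (real_of_int (placements (t + d) t) * ((fact t)\<^sup>2 * fact d))"
      unfolding n(3) by (simp add: c_def algebra_simps)
    then have prev_n: "real_of_int (placements (n - 1) t) * c = (real d + 2) * (real d + 1) * f"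
      unfolding placements_fact f_def .
    have prev_t: "real_of_int (if t = 0 then 0 else placements n (t - 1)) * c = (real t)\<^sup>2 * ((real t + d + 1)\<^sup>2 * f)"
    proof (cases t)
      case (Suc s)
      have ns: "n = s + (d + 2)" "s + (d + 2) = t + (d + 1)" using 4 Suc by auto
      have "real_of_int (placements n s) * c =
          (real t)\<^sup>2 * (real_of_int (placements (s + (d + 2)) s) * ((fact s)\<^sup>2 * fact (d + 2)))"
        using Suc by (simp add: ns(1) c_def power_mult_distrib)
      then have "real_of_int (placements n s) * c = (real t)\<^sup>2 * ((real t + d + 1)\<^sup>2 * f)"
        unfolding placements_fact unfolding ns(2) f1 f_def power_mult_distrib .
      then show ?thesis using Suc by simp
    qed simp
    have "real_of_int (placements (n + 1) t + (int n)\<^sup>2 * placements (n - 1) t) * c =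
        real_of_int ((if t = 0 then 0 else placements n (t - 1)) + (2 * int n + 1) * placements n t) * c"
    proof -
      have "real_of_int (placements (n + 1) t + (int n)\<^sup>2 * placements (n - 1) t) * c =
          real_of_int (placements (n + 1) t) * c + (real n)\<^sup>2 * (real_of_int (placements (n - 1) t) * c)"
        by (simp add: algebra_simps)
      also have "\<dots> = real_of_int (if t = 0 then 0 else placements n (t - 1)) * c +
          (2 * real n + 1) * (real_of_int (placements n t) * c)"
        unfolding next_n this_n prev_n prev_t by (simp add: 4 power2_eq_square algebra_simps)
      finally show ?thesis
        by (simp only: of_int_add of_int_mult of_int_power of_int_of_nat_eq of_int_numeral of_int_1
            distrib_right mult.assoc)
    qed
    then have "real_of_int (placements (n + 1) t + (int n)\<^sup>2 * placements (n - 1) t) =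
        real_of_int ((if t = 0 then 0 else placements n (t - 1)) + (2 * int n + 1) * placements n t)"
      using c by simp
    then show ?thesis by (simp only: of_int_eq_iff)
  qed
qed

lemma closed_form_upto: "n \<le> m \<Longrightarrow> closed_form n k = (\<Sum>t\<le>m. step_differences t k * placements n t)"
  unfolding closed_form_def by (intro sum.mono_neutral_left) (auto simp: placements_beyond)

lemma closed_form_rec:
  "closed_form (n + 1) k + (int n)\<^sup>2 * closed_form (n - 1) k =
    closed_form n (k + 1) + (2 * int n - 1) * closed_form n k + closed_form n (k - 1)"
proof -
  let ?w = step_differences
  have upto: "closed_form (n - 1) k = (\<Sum>t\<le>n + 1. ?w t k * placements (n - 1) t)"
    "closed_form n k = (\<Sum>t\<le>n + 1. ?w t k * placements n t)"
    by (rule closed_form_upto; simp)+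
  have "closed_form (n + 1) k + (int n)\<^sup>2 * closed_form (n - 1) k =
      (\<Sum>t\<le>n + 1. ?w t k * (placements (n + 1) t + (int n)\<^sup>2 * placements (n - 1) t))"
    unfolding closed_form_upto[of "n + 1" "n + 1", OF le_refl] upto(1) sum_distrib_left sum.distrib[symmetric]
    by (intro sum.cong refl) (simp only: algebra_simps)
  also have "\<dots> = (\<Sum>t\<le>n + 1. ?w t k * (if t = 0 then 0 else placements n (t - 1))) +
      (2 * int n + 1) * (\<Sum>t\<le>n + 1. ?w t k * placements n t)"
    unfolding placements_rec sum_distrib_left sum.distrib[symmetric]
    by (intro sum.cong refl) (simp only: algebra_simps)
  also have "(\<Sum>t\<le>n + 1. ?w t k * placements n t) = closed_form n k"
    by (rule upto(2)[symmetric])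
  also have "(\<Sum>t\<le>n + 1. ?w t k * (if t = 0 then 0 else placements n (t - 1))) = (\<Sum>t\<le>n. ?w (Suc t) k * placements n t)"
    by (simp add: sum.atMost_Suc_shift del: sum.atMost_Suc step_differences.simps)
  also have "\<dots> = closed_form n (k - 1) - 2 * closed_form n k + closed_form n (k + 1)"
    unfolding closed_form_def sum_distrib_left sum_subtractf[symmetric] sum.distrib[symmetric]
    by (intro sum.cong refl) (simp add: algebra_simps)
  finally show ?thesis by (simp add: algebra_simps)
qed

text \<open>
The one fact special to the indicator function of \<open>k \<le> 0\<close>: its difference is supported at \<open>k = 0\<close>,
where it is killed by the factor \<open>k\<close>. Each second difference adds 1 to the factor on the right.
\<close>

lemma step_differences_first_order:
  "k * (step_differences t k - step_differences t (k + 1)) =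
    int t * (step_differences t k + step_differences t (k + 1))"
proof (induction t arbitrary: k)
  case 0
  then show ?case by auto
next
  case (Suc t)
  have "k - 1 + 1 = k" "k + 1 - 1 = k" "k + 1 + 1 = k + 2" by auto
  then show ?case using Suc.IH[of k] Suc.IH[of "k - 1"] Suc.IH[of "k + 1"]
    by (simp add: algebra_simps)
qed

text \<open>
By the first-order relation the coefficients \<open>n - k + 1\<close> and \<open>n + k + 1\<close> act on the \<open>t\<close>-th summand as
multiplication by \<open>n + 1 - t\<close>, and that factor lowers \<open>n + 1\<close> to \<open>n\<close> in \<open>placements\<close>.
\<close>

lemma closed_form_adjacent:
  "(int n + 1)\<^sup>2 * (closed_form n k + closed_form n (k + 1)) =
    (int n - k + 1) * closed_form (n + 1) k + (int n + k + 1) * closed_form (n + 1) (k + 1)"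
proof -
  let ?w = step_differences
  have "(int n + 1)\<^sup>2 * (closed_form n k + closed_form n (k + 1)) =
      (\<Sum>t\<le>n + 1. (?w t k + ?w t (k + 1)) * ((int n + 1)\<^sup>2 * placements n t))"
    unfolding closed_form_upto[of n "n + 1", OF le_add1] sum.distrib[symmetric] sum_distrib_left
    by (intro sum.cong refl) (simp only: algebra_simps)
  also have "\<dots> = (\<Sum>t\<le>n + 1. (?w t k + ?w t (k + 1)) * ((int n + 1 - int t) * placements (n + 1) t))"
    using placements_absorb by (intro sum.cong refl) simp
  also have "\<dots> = (\<Sum>t\<le>n + 1. ((int n - k + 1) * ?w t k + (int n + k + 1) * ?w t (k + 1)) * placements (n + 1) t)"
  proof (rule sum.cong[OF refl])
    fix t
    have "(?w t k + ?w t (k + 1)) * (int n + 1 - int t) = (int n - k + 1) * ?w t k + (int n + k + 1) * ?w t (k + 1)"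
      using step_differences_first_order[of k t] by (simp add: algebra_simps)
    then show "(?w t k + ?w t (k + 1)) * ((int n + 1 - int t) * placements (n + 1) t) =
        ((int n - k + 1) * ?w t k + (int n + k + 1) * ?w t (k + 1)) * placements (n + 1) t"
      by (simp only: mult.assoc[symmetric])
  qed
  also have "\<dots> = (int n - k + 1) * closed_form (n + 1) k + (int n + k + 1) * closed_form (n + 1) (k + 1)"
    unfolding closed_form_def sum_distrib_left sum.distrib[symmetric]
    by (intro sum.cong refl) (simp only: algebra_simps)
  finally show ?thesis .
qed

text \<open>
The bounds on \<open>r\<close> ensure that there are enough rows for each instance of the recurrence; they are
preserved when \<open>n\<close> is lowered and \<open>k\<close> is lowered by no more than \<open>n\<close>.
\<close>

lemma norm_walks_eq_closed_form:
  assumes "1 \<le> r"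
  shows "n \<le> r \<Longrightarrow> int n - k \<le> int r \<Longrightarrow> norm_walks r n k = closed_form n k"
proof (induction n arbitrary: k rule: less_induct)
  case (less n)
  show ?case
  proof (cases n)
    case 0
    then show ?thesis using norm_walks_0[OF assms, of k] less.prems
      by (simp add: closed_form_def placements_def)
  next
    case (Suc m)
    have IH: "norm_walks r m k' = closed_form m k'" if "k' \<ge> k - 1" for k'
      using less.IH[of m k'] less.prems Suc that by auto
    have prev: "(int m)\<^sup>2 * norm_walks r (m - 1) k = (int m)\<^sup>2 * closed_form (m - 1) k"
      using less.IH[of "m - 1" k] less.prems Suc by (cases m) auto
    have "m \<le> r" "int m - k < int r" using less.prems Suc by auto
    from norm_walks_rec[OF assms this] have "norm_walks r (m + 1) k + (int m)\<^sup>2 * closed_form (m - 1) k =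
        closed_form m (k + 1) + (2 * int m - 1) * closed_form m k + closed_form m (k - 1)"
      unfolding prev using IH[of k] IH[of "k - 1"] IH[of "k + 1"] by simp
    then show ?thesis using closed_form_rec[of m k] Suc by simp
  qed
qed

lemma card_row_le_length: "card (row xs) \<le> length xs"
  using card_mono[OF finite_set row_subset, of xs] card_length[of xs] by linarith

lemma LIS_bounds:
  assumes "\<sigma> permutes {1..n}"
  shows "LIS n \<sigma> \<le> n" "1 \<le> n \<Longrightarrow> 1 \<le> LIS n \<sigma>"
proof -
  have L: "LIS n \<sigma> = card (row (rev (map \<sigma> [1..<n + 1])))"
    by (rule LIS_eq_card_row[OF permutes_inj_on[OF assms]])
  then show "LIS n \<sigma> \<le> n" using card_row_le_length[of "rev (map \<sigma> [1..<n + 1])"]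
    by (simp del: upt_Suc)
  assume "1 \<le> n"
  then have "row (rev (map \<sigma> [1..<n + 1])) \<noteq> {}" by (auto simp: bump_def)
  then show "1 \<le> LIS n \<sigma>" unfolding L using finite_row by (simp add: Suc_le_eq card_gt_0_iff)
qed

text \<open>
The exception \<open>n = k = 0\<close> is the empty permutation, which the closed form counts and \<open>num_LIS\<close> does not.
\<close>

lemma num_LIS_eq_closed_form:
  assumes "0 \<le> k" "int n \<le> 2 * k + 1" "n \<noteq> 0 \<or> k \<noteq> 0"
  shows "int (num_LIS n k) = closed_form n k"
proof -
  let ?A = "{\<sigma>. \<sigma> permutes {1..n} \<and> LIS n \<sigma> = nat k}"
  have "num_LIS n k = card ?A"
  proof (cases "1 \<le> k \<and> k \<le> int n")
    case True
    then show ?thesis by (auto simp: num_LIS_def intro!: arg_cong[of _ _ card])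
  next
    case False
    then have "?A = {}" using LIS_bounds[of _ n] assms by fastforce
    then have "card ?A = 0" by (simp only: card.empty)
    moreover have "num_LIS n k = 0" using False unfolding num_LIS_def by (simp only: if_False)
    ultimately show ?thesis by simp
  qed
  also have "int (card ?A) = (\<Sum>x\<in>level (n + 1) 0 (int n) k. (walks (n + 1) n x)\<^sup>2)"
    using card_LIS_eq_sum_walks[of n "n + 1" "nat k"] assms(1) by simp
  also have "\<dots> = norm_walks (n + 1) n k"
    using norm_walks_eq_chamber_0[of "n + 1" n k] assms(2) by simp
  also have "\<dots> = closed_form n k"
    using norm_walks_eq_closed_form[of "n + 1" n k] assms(1) by simp
  finally show ?thesis .
qed

theorem theorem1:
  fixes n :: nat and k :: int
  assumes "n \<ge> 1" and "real n / 2 \<le> real_of_int k"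
  shows "(real n / 2 \<noteq> real_of_int k \<longrightarrow>
            int (num_LIS (n + 1) k) + (int n)^2 * int (num_LIS (n - 1) k)
              = int (num_LIS n (k + 1)) + (2 * int n - 1) * int (num_LIS n k) + int (num_LIS n (k - 1)))
       \<and> (int n + 1)^2 * (int (num_LIS n k) + int (num_LIS n (k + 1)))
              = (int n - k + 1) * int (num_LIS (n + 1) k) + (int n + k + 1) * int (num_LIS (n + 1) (k + 1))"
proof -
  have "real_of_int (int n) \<le> real_of_int (2 * k)" using assms(2) by simp
  then have nk: "int n \<le> 2 * k" by (simp only: of_int_le_iff)
  then have k: "1 \<le> k" using assms(1) by linarith
  have num: "int (num_LIS (n + 1) k) = closed_form (n + 1) k"
    "int (num_LIS n k) = closed_form n k"
    "int (num_LIS n (k + 1)) = closed_form n (k + 1)"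
    "int (num_LIS (n + 1) (k + 1)) = closed_form (n + 1) (k + 1)"
    "int (num_LIS (n - 1) k) = closed_form (n - 1) k"
    using nk k assms(1) by (auto intro!: num_LIS_eq_closed_form)
  have prev: "int (num_LIS n (k - 1)) = closed_form n (k - 1)" if "real n / 2 \<noteq> real_of_int k"
  proof -
    have "int n \<noteq> 2 * k"
    proof
      assume "int n = 2 * k"
      then have "real_of_int (int n) = real_of_int (2 * k)" by (simp only:)
      then show False using that by simp
    qed
    then show ?thesis using nk k assms(1) by (intro num_LIS_eq_closed_form) auto
  qed
  show ?thesis unfolding num using prev closed_form_rec[of n k] closed_form_adjacent[of n k] by simp
qed

end
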